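(* Let $g_1(n)$ and $h_1(n)$ be defined by $$(-q,-q^{4};q^{5})_{\infty}^{2}(q^{4},q^{6};q^{10})_{\infty}=\sum_{n=0}^{\infty}g_{1}(n)q^{n},\qquad (-q^{2},-q^{3};q^{5})_{\infty}^{2}(q^{2},q^{8};q^{10})_{\infty}=\sum_{n=0}^{\infty}h_{1}(n)q^{n}.$$ Then for every integer $n\ge 0$: (1) $g_{1}(5n)$ is the number of partitions of $n$ into parts congruent to $\pm1,\pm2,\pm4\pmod{10}$, where parts $\equiv\pm1$ and $\equiv\pm4$ appear in two flavours; (2) $g_{1}(5n+1)$ is twice the number of partitions of $n$ into parts congruent to $\pm1,\pm2,\pm3,\pm4\pmod{10}$, where parts $\equiv\pm2$ appear in two flavours; (3) $g_{1}(5n+2)$ is the number of partitions of $n$ into parts congruent to $\pm1,\pm4\pmod{10}$, where parts $\equiv\pm1$ appear in two flavours and parts $\equiv\pm4$ appear in three flavours; (4) $g_{1}(5n+4)$ is the number of partitions of $n$ into parts congruent to $\pm2,\pm3,\pm4\pmod{10}$, where parts $\equiv\pm2$ and $\equiv\pm3$ appear in two flavours; (5) $h_{1}(5n)$ is the number of partitions of $n$ into parts congruent to $\pm1,\pm2,\pm4\pmod{10}$, where parts $\equiv\pm1$ and $\equiv\pm4$ appear in two flavours; (6) $h_{1}(5n+2)$ is the number of partitions of $n$ into parts congruent to $\pm2,\pm3\pmod{10}$, where parts $\equiv\pm3$ appear in two flavours and parts $\equiv\pm2$ appear in three flavours; (7) $h_{1}(5n+3)$ is twice the number of partitions of $n$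 into parts congruent to $\pm1,\pm2,\pm3,\pm4\pmod{10}$, where parts $\equiv\pm4$ appear in two flavours; (8) $-h_{1}(5n+4)$ is the number of partitions of $n$ into parts congruent to $\pm2,\pm3,\pm4\pmod{10}$, where parts $\equiv\pm2$ and $\equiv\pm3$ appear in two flavours.
   Context: Notation: for $|q|<1$, $(a;q)_{\infty}:=\prod_{n=0}^{\infty}(1-aq^{n})$ and $(a_{1},\ldots,a_{m};q)_{\infty}:=(a_{1};q)_{\infty}\cdots(a_{m};q)_{\infty}$; similarly with $q$ replaced by $q^k$ in the base. A part size "appearing in $k$ flavours" means that there are $k$ distinguishable kinds (colours) of parts of that size; parts whose flavours are not specified come in one flavour. Partitions are multisets of such (flavoured) positive parts. *)

theory Defs
  imports "HOL-Analysis.Analysis" "HOL-Library.Multiset" "HOL-Number_Theory.Cong"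
begin

definition qpochhammer_inf :: "complex list \<Rightarrow> complex \<Rightarrow> complex" where
  "qpochhammer_inf as q = (\<Prod>a\<leftarrow>as. \<Prod>n. 1 - a * q ^ n)"

definition cong_pm :: "nat \<Rightarrow> int set \<Rightarrow> nat set" where
  "cong_pm m R = {k. \<exists>r\<in>R. [int k = r] (mod int m) \<or> [int k = - r] (mod int m)}"

text \<open>The pair \<open>(k, c)\<close> is a part of size \<open>k\<close> in flavour number \<open>c\<close>; parts of size \<open>k\<close>
  come in the flavours \<open>0, \<dots>, flav k - 1\<close>.\<close>

definition flavoured_partitions ::
    "nat set \<Rightarrow> (nat \<Rightarrow> nat) \<Rightarrow> nat \<Rightarrow> (nat \<times> nat) multiset set" where
  "flavoured_partitions S flav n =
     {P. (\<forall>(k, c) \<in># P. 0 < k \<and> k \<in> S \<and> c < flav k) \<and> (\<Sum>(k, c) \<in># P. k) = n}"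

definition num_partitions :: "nat set \<Rightarrow> (nat \<Rightarrow> nat) \<Rightarrow> nat \<Rightarrow> nat" where
  "num_partitions S flav n = card (flavoured_partitions S flav n)"

end

theory Submission imports Defs begin

text \<open>
Write \<open>(q)\<^sub>k = (q^k; q^k)\<^sub>\<infinity>\<close>, and let \<open>f(a, b)\<close> be the sum of \<open>a^(n(n+1)/2) b^(n(n-1)/2)\<close>
over all integers \<open>n\<close>. The power series are compared for real \<open>0 < q < 1\<close> only: two power
series that agree there have the same coefficients (\<open>powser_coeffs_zero_of_real_zeros\<close>).

Put \<open>t = q^5\<close>. Multiplying the two given products by \<open>(t)\<^sub>1\<^sup>2 (t)\<^sub>2\<close> does not mix residue
classes of exponents modulo 5, and by the Jacobi triple product it turns them into the theta products
\<open>f(q, q^4)\<^sup>2 f(-q^4, -q^6)\<close> and \<open>f(q^2, q^3)\<^sup>2 f(-q^2, -q^8)\<close>. These are 5-dissected by changing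
coordinates in the lattice of summation. Splitting a square lattice into the two cosets
of \<open>(1 + \<i>)\<int>[\<i>]\<close> (\<open>theta_product_2\<close>) extracts from the squared factor the series
\<open>\<Phi> = theta 1 t\<close> and \<open>\<Psi> = theta t t\<close>, which depend on \<open>t\<close> alone; what remains is a product of two
theta series with base \<open>q^5\<close>, and the five cosets of \<open>(1 + 2\<i>)\<int>[\<i>]\<close> (\<open>theta_product_5\<close>) are
exactly the five classes of exponents modulo 5. Every component is again a product of theta series
in \<open>t\<close>, up to a factor which is one of only three combinations of \<open>\<Phi>\<close> and \<open>\<Psi>\<close>
(\<open>theta_dissections\<close>).

The core of the proof is that these three combinations are \<open>E\<^sub>1\<^sup>2\<close>, \<open>E\<^sub>2\<^sup>2\<close> and \<open>2 E\<^sub>1 E\<^sub>2\<close>, where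
\<open>E\<^sub>1 = f(-t^2, -t^3)\<close> and \<open>E\<^sub>2 = f(-t, -t^4)\<close> (\<open>pentagonal_square_representations\<close>). For the last one,
\<open>E\<^sub>1 E\<^sub>2 = (t)\<^sub>1 (t)\<^sub>5\<close>, and by Euler's pentagonal number theorem this is a double series whose
quadratic form is \<open>m\<^sup>2 + 5 n\<^sup>2\<close>; it is compared with the combination of \<open>\<Phi>\<close> and \<open>\<Psi>\<close> through
a sublattice of index 3, where one coset cancels and the two others agree, which is where the
factor 2 in parts (2) and (7) comes from (\<open>theta_euler_product\<close>). The squares then follow by algebra
from this identity and from 5-dissections of \<open>\<Phi>\<^sup>2\<close> and \<open>\<Psi>\<^sup>2\<close>: the products involved are
the two roots of one quadratic equation, and positivity for \<open>0 < t < 1\<close> tells which is which.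

At this point each component divided by \<open>(t)\<^sub>1\<^sup>2 (t)\<^sub>2\<close> is a product of powers of \<open>1 - t^k\<close>
whose exponents depend on \<open>k\<close> modulo 10 only, and reading off these exponents gives the eight
kinds of partitions (\<open>exponent_identities\<close>).
\<close>

section \<open>Bilateral theta series\<close>

text \<open>
For \<open>z = s^(a - b)\<close> and \<open>q = s^(a + b)\<close> this is Ramanujan's \<open>f(s^(2a), s^(2b))\<close>. Keeping \<open>z\<close> and \<open>q\<close>
as the arguments makes the quadratic part of the exponent diagonal, so that changes of lattice
coordinates act on it by norms of Gaussian integers; the price is that \<open>s\<close> is a square root of the
natural variable.
\<close>

definition theta :: "real \<Rightarrow> real \<Rightarrow> real" where
  "theta z q = (\<Sum>\<^sub>\<infinity>n::int. z powi n * q powi n\<^sup>2)"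

lemma infsum_int_split:
  fixes f :: "int \<Rightarrow> real"
  assumes "f summable_on UNIV"
  shows "summable (\<lambda>n. f (int n))" "summable (\<lambda>n. f (- int n - 1))"
    "infsum f UNIV = (\<Sum>n. f (int n)) + (\<Sum>n. f (- int n - 1))"
proof -
  have b1: "bij_betw int UNIV {0..}"
    by (rule bij_betwI[of _ _ _ nat]) auto
  have b2: "bij_betw (\<lambda>n. - int n - 1) UNIV {..<0}"
    by (rule bij_betwI[of _ _ _ "\<lambda>k. nat (- k - 1)"]) auto
  have s1: "f summable_on {0..}" and s2: "f summable_on {..<0}"
    using assms summable_on_subset_banach by blast+
  have t1: "(\<lambda>n. f (int n)) summable_on UNIV"
    using summable_on_reindex_bij_betw[OF b1, of f] s1 by simp
  have t2: "(\<lambda>n. f (- int n - 1)) summable_on UNIV"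
    using summable_on_reindex_bij_betw[OF b2, of f] s2 by simp
  show "summable (\<lambda>n. f (int n))" "summable (\<lambda>n. f (- int n - 1))"
    using t1 t2 by (auto intro: summable_on_imp_summable)
  have "infsum f UNIV = infsum f ({0..} \<union> {..<0})"
    by (rule arg_cong[of _ _ "infsum f"]) auto
  also have "\<dots> = infsum f {0..} + infsum f {..<0}"
    by (rule infsum_Un_disjoint) (use s1 s2 in auto)
  also have "infsum f {0..} = (\<Sum>\<^sub>\<infinity>n. f (int n))"
    using infsum_reindex_bij_betw[OF b1, of f] by simp
  also have "\<dots> = (\<Sum>n. f (int n))"
    using t1 by (metis has_sum_imp_sums has_sum_infsum sums_unique)
  also have "infsum f {..<0} = (\<Sum>\<^sub>\<infinity>n. f (- int n - 1))"
    using infsum_reindex_bij_betw[OF b2, of f] by simp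
  also have "\<dots> = (\<Sum>n. f (- int n - 1))"
    using t2 by (metis has_sum_imp_sums has_sum_infsum sums_unique)
  finally show "infsum f UNIV = (\<Sum>n. f (int n)) + (\<Sum>n. f (- int n - 1))" .
qed

lemma summable_on_int_splitI:
  fixes f :: "int \<Rightarrow> real"
  assumes "summable (\<lambda>n. \<bar>f (int n)\<bar>)" "summable (\<lambda>n. \<bar>f (- int n - 1)\<bar>)"
  shows "f summable_on UNIV"
proof -
  have b1: "bij_betw int UNIV {0..}"
    by (rule bij_betwI[of _ _ _ nat]) auto
  have b2: "bij_betw (\<lambda>n. - int n - 1) UNIV {..<0}"
    by (rule bij_betwI[of _ _ _ "\<lambda>k. nat (- k - 1)"]) auto
  have "f summable_on {0..}"
    using summable_on_reindex_bij_betw[OF b1, of f] assms(1)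
    by (auto intro: norm_summable_imp_summable_on)
  moreover have "f summable_on {..<0}"
    using summable_on_reindex_bij_betw[OF b2, of f] assms(2)
    by (auto intro: norm_summable_imp_summable_on)
  ultimately have "f summable_on ({0..} \<union> {..<0})"
    by (rule summable_on_union)
  thus ?thesis
    by (rule back_subst[of "\<lambda>S. f summable_on S"]) auto
qed

text \<open>
The ratio of consecutive terms is \<open>z q^(2n+1)\<close>, which tends to 0 for every \<open>z\<close>.
\<close>

lemma summable_power_mult_power_square:
  fixes z q :: real
  assumes "0 < q" "q < 1"
  shows "summable (\<lambda>n. \<bar>z ^ n * q ^ (n\<^sup>2)\<bar>)"
proof -
  have "(\<lambda>n. \<bar>z\<bar> * q * (q\<^sup>2) ^ n) \<longlonglongrightarrow> \<bar>z\<bar> * q * 0"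
    using assms by (intro tendsto_mult tendsto_const LIMSEQ_realpow_zero) 
      (auto intro: power_Suc_less_one[of q 1, simplified numeral_2_eq_2[symmetric]] simp: abs_square_less_1)
  then have "eventually (\<lambda>n. \<bar>z\<bar> * q * (q\<^sup>2) ^ n < 1/2) sequentially"
    by (rule order_tendstoD) simp
  then obtain N where N: "\<And>n. n \<ge> N \<Longrightarrow> \<bar>z\<bar> * q * (q\<^sup>2) ^ n < 1/2"
    by (auto simp: eventually_sequentially)
  show ?thesis
  proof (rule summable_ratio_test[of "1/2" N])
    fix n assume "n \<ge> N"
    have "(Suc n)\<^sup>2 = n\<^sup>2 + (2 * n + 1)"
      by (simp add: power2_eq_square)
    then have "\<bar>z ^ Suc n * q ^ ((Suc n)\<^sup>2)\<bar> = (\<bar>z\<bar> * q * (q\<^sup>2) ^ n) * \<bar>z ^ n * q ^ (n\<^sup>2)\<bar>"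
      using assms by (simp add: abs_mult power_add power_mult)
    also have "\<dots> \<le> 1/2 * \<bar>z ^ n * q ^ (n\<^sup>2)\<bar>"
      using N[OF \<open>n \<ge> N\<close>] by (intro mult_right_mono) auto
    finally show "norm \<bar>z ^ Suc n * q ^ ((Suc n)\<^sup>2)\<bar> \<le> 1/2 * norm \<bar>z ^ n * q ^ (n\<^sup>2)\<bar>"
      by simp
  qed simp
qed

lemma theta_summable:
  fixes z q :: real
  assumes "0 < q" "q < 1" "z \<noteq> 0"
  shows "(\<lambda>n::int. z powi n * q powi n\<^sup>2) summable_on UNIV"
proof (rule summable_on_int_splitI)
  have e: "q powi (int n)\<^sup>2 = q ^ (n\<^sup>2)" for n
    by (metis of_nat_power power_int_of_nat)
  show "summable (\<lambda>n. \<bar>z powi int n * q powi (int n)\<^sup>2\<bar>)"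
    using summable_power_mult_power_square[OF assms(1,2), of z] by (simp only: e power_int_of_nat)
  have "summable (\<lambda>n. \<bar>(1/z) ^ Suc n * q ^ ((Suc n)\<^sup>2)\<bar>)"
    using summable_power_mult_power_square[OF assms(1,2), of "1/z"]
    by (subst summable_Suc_iff[of "\<lambda>n. \<bar>(1/z) ^ n * q ^ (n\<^sup>2)\<bar>"])
  moreover have "z powi (- int n - 1) * q powi (- int n - 1)\<^sup>2 = (1/z) ^ Suc n * q ^ ((Suc n)\<^sup>2)" for n
  proof -
    have "z powi (- int n - 1) = (1/z) ^ Suc n"
      by (metis (no_types, opaque_lifting) add.commute diff_conv_add_uminus minus_add_distrib of_nat_Suc
          power_int_minus_divide power_int_of_nat power_one_over)
    moreover have "(- int n - 1)\<^sup>2 = (int (Suc n))\<^sup>2"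
      by (simp add: power2_eq_square algebra_simps)
    ultimately show ?thesis using e[of "Suc n"] by simp
  qed
  ultimately show "summable (\<lambda>n. \<bar>z powi (- int n - 1) * q powi (- int n - 1)\<^sup>2\<bar>)"
    by (simp only:)
qed

lemma theta_inverse:
  assumes "z \<noteq> 0"
  shows "theta (inverse z) q = theta z q"
  unfolding theta_def
  by (rule infsum_reindex_bij_witness[of _ uminus uminus])
     (auto simp: power_int_minus power_int_inverse)

lemma theta_shift:
  assumes "0 < q" "z \<noteq> 0"
  shows "theta (z * q\<^sup>2) q = theta z q / (z * q)"
proof -
  have "theta z q = (\<Sum>\<^sub>\<infinity>n::int. z powi (n + 1) * q powi (n + 1)\<^sup>2)"
    unfolding theta_def
    by (rule infsum_reindex_bij_witness[of _ "\<lambda>n. n + 1" "\<lambda>n. n - 1"]) auto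
  also have "\<dots> = (\<Sum>\<^sub>\<infinity>n::int. (z * q) * ((z * q\<^sup>2) powi n * q powi n\<^sup>2))"
  proof (rule infsum_cong)
    fix n :: int
    have "q powi (n + 1)\<^sup>2 = q powi n\<^sup>2 * (q\<^sup>2) powi n * q"
      using assms by (simp add: power2_sum power_int_add power_int_power)
    then show "z powi (n + 1) * q powi (n + 1)\<^sup>2 = (z * q) * ((z * q\<^sup>2) powi n * q powi n\<^sup>2)"
      using assms by (simp add: power_int_add power_int_mult_distrib)
  qed
  also have "\<dots> = (z * q) * theta (z * q\<^sup>2) q"
    unfolding theta_def by (rule infsum_cmult_right')
  finally show ?thesis using assms by simp
qed

text \<open>
At \<open>z = -q\<close> the inversion and the shift combine to \<open>theta z q = - theta z q\<close>.
\<close>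

lemma theta_neg_zero:
  assumes "0 < q"
  shows "theta (- q) q = 0"
proof -
  have "theta (inverse (- q) * q\<^sup>2) q = theta (inverse (- q)) q / (inverse (- q) * q)"
    by (rule theta_shift) (use assms in auto)
  also have "\<dots> = - theta (- q) q"
    using assms by (subst theta_inverse) auto
  also have "inverse (- q) * q\<^sup>2 = - q"
    using assms by (simp add: field_simps power2_eq_square)
  finally show ?thesis by simp
qed

lemma theta_pos:
  assumes "0 < q" "q < 1" "0 < z"
  shows "theta z q > 0"
proof -
  have "0 < z powi 0 * q powi 0\<^sup>2" by simp
  also have "\<dots> = (\<Sum>\<^sub>\<infinity>n\<in>{0::int}. z powi n * q powi n\<^sup>2)" by simp
  also have "\<dots> \<le> theta z q" unfolding theta_def
    by (rule infsum_mono2) (use assms theta_summable in auto)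
  finally show ?thesis .
qed

lemma has_sum_product_real:
  fixes f :: "'a \<Rightarrow> real" and g :: "'b \<Rightarrow> real"
  assumes "(f has_sum a) A" "(g has_sum b) B"
  shows "((\<lambda>(x, y). f x * g y) has_sum (a * b)) (A \<times> B)"
proof -
  have f: "f summable_on A" and g: "g summable_on B"
    using assms has_sum_imp_summable by auto
  have fa: "(\<lambda>x. norm (f x)) summable_on A" and ga: "(\<lambda>y. norm (g y)) summable_on B"
    using f g by (simp_all only: summable_on_iff_abs_summable_on_real[symmetric])
  have "(\<lambda>z. norm (case z of (x, y) \<Rightarrow> f x * g y)) summable_on (A \<times> B)"
    unfolding Infinite_Sum.abs_summable_on_Sigma_iff
    using fa ga by (auto simp: abs_mult infsum_cmult_right' intro!: summable_on_cmult_right summable_on_cmult_left)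
  then have s: "(\<lambda>(x, y). f x * g y) summable_on (A \<times> B)"
    by (rule Infinite_Sum.abs_summable_summable)
  have "(\<Sum>\<^sub>\<infinity>(x, y)\<in>A \<times> B. f x * g y) = (\<Sum>\<^sub>\<infinity>x\<in>A. \<Sum>\<^sub>\<infinity>y\<in>B. f x * g y)"
    using infsum_Sigma'_banach[of "\<lambda>x y. f x * g y" A "\<lambda>_. B"] s by simp
  also have "\<dots> = a * b"
    by (simp only: infsum_cmult_right' infsum_cmult_left' infsumI[OF assms(1)] infsumI[OF assms(2)])
  finally show ?thesis
    using has_sum_infsum[OF s] by simp
qed

lemma theta_product_has_sum:
  assumes "0 < p" "p < 1" "0 < q" "q < 1" "z \<noteq> 0" "w \<noteq> 0"
  shows "((\<lambda>(m::int, n::int). (z powi m * p powi m\<^sup>2) * (w powi n * q powi n\<^sup>2)) has_sum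
    (theta z p * theta w q)) UNIV"
  using has_sum_product_real[OF theta_summable[THEN has_sum_infsum] theta_summable[THEN has_sum_infsum]] assms
  unfolding theta_def UNIV_Times_UNIV by blast

section \<open>Products of two theta series as sums over a plane lattice\<close>

lemma has_sum_finite_fibres:
  fixes F :: "'a \<Rightarrow> real" and g :: "'r \<times> 'b \<Rightarrow> 'a"
  assumes "bij_betw g (R \<times> UNIV) UNIV" "finite R"
    and "\<And>r. r \<in> R \<Longrightarrow> ((\<lambda>y. F (g (r, y))) has_sum S r) UNIV"
  shows "(F has_sum (\<Sum>r\<in>R. S r)) UNIV"
proof -
  have "((\<lambda>y. F (g y)) has_sum (\<Sum>r\<in>R. S r)) (\<Union>r\<in>R. Pair r ` UNIV)"
  proof (rule sum_has_sum)
    fix r assume "r \<in> R"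
    then show "((\<lambda>y. F (g y)) has_sum S r) (Pair r ` UNIV)"
      using assms(3) by (subst has_sum_reindex) (auto simp: inj_on_def o_def)
  qed (use assms in auto)
  also have "(\<Union>r\<in>R. Pair r ` UNIV) = R \<times> (UNIV :: 'b set)" by auto
  finally show ?thesis
    using has_sum_reindex_bij_betw[OF assms(1), of F] by simp
qed

text \<open>
\<open>(m, n) = (r + x - 2s, 2x + s)\<close> says that \<open>m + n\<i> = r + (x + s\<i>)(1 + 2\<i>)\<close>. The numbers \<open>-2, ..., 2\<close>
represent the five classes modulo \<open>1 + 2\<i>\<close>, and as multiplication by \<open>1 + 2\<i>\<close> scales norms by 5,
the exponent has no mixed term \<open>x s\<close>, and the sum over each class is a product again.
\<close>

lemma theta_product_5:
  fixes z w p :: real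
  assumes p: "0 < p" "p < 1" and nz: "z \<noteq> 0" "w \<noteq> 0"
  shows "theta z p * theta w p = (\<Sum>r\<in>{-2..2::int}. z powi r * p powi r\<^sup>2 *
    (theta (z * w\<^sup>2 * p powi (2 * r)) (p ^ 5) * theta (w * z powi (-2) * p powi (-4 * r)) (p ^ 5)))"
proof -
  let ?F = "\<lambda>(m::int, n::int). (z powi m * p powi m\<^sup>2) * (w powi n * p powi n\<^sup>2)"
  let ?g = "\<lambda>(r::int, x::int, s::int). (r + x - 2 * s, 2 * x + s)"
  let ?i = "\<lambda>(m::int, n::int). let r = (m + 2 * n + 2) mod 5 - 2; s = (n - 2 * m + 2 * r) div 5
              in (r, m - r + 2 * s, s)"
  have bij: "bij_betw ?g ({-2..2} \<times> UNIV) UNIV"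
  proof (rule bij_betwI[of _ _ _ ?i])
    show "?i \<in> UNIV \<rightarrow> {-2..2} \<times> UNIV"
    proof
      fix y :: "int \<times> int"
      obtain m n where y: "y = (m, n)" by (cases y)
      have "0 \<le> (m + 2 * n + 2) mod 5" "(m + 2 * n + 2) mod 5 < 5" by simp_all
      then have "(m + 2 * n + 2) mod 5 - 2 \<in> {-2..2}" by simp
      then show "?i y \<in> {-2..2} \<times> UNIV" unfolding y by (simp add: Let_def)
    qed
    show "?g (?i y) = y" if "y \<in> UNIV" for y
    proof -
      obtain m n where y: "y = (m, n)" by (cases y)
      define r where "r = (m + 2 * n + 2) mod 5 - 2"
      define s where "s = (n - 2 * m + 2 * r) div 5"
      define k where "k = (m + 2 * n + 2) div 5"
      have "m + 2 * n + 2 = 5 * k + (r + 2)"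
        unfolding r_def k_def by simp
      then have "n - 2 * m + 2 * r = 5 * (n - 2 * k)" by (simp add: algebra_simps)
      then have "5 * s = n - 2 * m + 2 * r"
        unfolding s_def by (simp only:) simp
      moreover have "?i (m, n) = (r, m - r + 2 * s, s)"
        unfolding r_def s_def by (simp only: Let_def prod.case)
      ultimately show ?thesis
        unfolding y by (simp only: prod.case) simp
    qed
    show "?i (?g y) = y" if y: "y \<in> {-2..2} \<times> UNIV" for y
    proof -
      obtain r x s where y: "y = (r, x, s)" "-2 \<le> r" "r \<le> 2" using y by (cases y) auto
      have "r + x - 2 * s + 2 * (2 * x + s) + 2 = (r + 2) + x * 5" by simp
      then have "(r + x - 2 * s + 2 * (2 * x + s) + 2) mod 5 = (r + 2) mod 5"
        by (metis mod_mult_self1)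
      also have "\<dots> = r + 2" using y by (intro mod_pos_pos_trivial) auto
      finally have 1: "(r + x - 2 * s + 2 * (2 * x + s) + 2) mod 5 = r + 2" .
      have 2: "(2 * x + s - 2 * (r + x - 2 * s) + 2 * r) div 5 = s" by simp
      show ?thesis unfolding y by (simp only: prod.case 1 2 Let_def) simp
    qed
  qed (auto)
  have term_eq: "?F (?g (r, x, s)) = z powi r * p powi r\<^sup>2 *
     (((z * w\<^sup>2 * p powi (2 * r)) powi x * (p ^ 5) powi x\<^sup>2) *
      ((w * z powi (-2) * p powi (-4 * r)) powi s * (p ^ 5) powi s\<^sup>2))" for r x s
  proof -
    have "(r + x - 2 * s)\<^sup>2 + (2 * x + s)\<^sup>2 = r\<^sup>2 + (2 * r * x + (5 * x\<^sup>2 + ((-4 * r) * s + 5 * s\<^sup>2)))"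
      by (simp add: power2_eq_square algebra_simps)
    then have "p powi (r + x - 2 * s)\<^sup>2 * p powi (2 * x + s)\<^sup>2 =
       p powi r\<^sup>2 * (p powi (2 * r * x) * (p powi (5 * x\<^sup>2) * (p powi ((-4 * r) * s) * p powi (5 * s\<^sup>2))))"
      using p by (simp add: power_int_add[symmetric])
    moreover have "z powi (r + x - 2 * s) = z powi r * (z powi x * z powi (-2 * s))"
      using nz by (simp add: power_int_add[symmetric] algebra_simps)
    moreover have "w powi (2 * x + s) = w powi (2 * x) * w powi s"
      using nz by (simp add: power_int_add[symmetric])
    moreover have "(z * w\<^sup>2 * p powi (2 * r)) powi x = z powi x * w powi (2 * x) * p powi (2 * r * x)"
      by (simp only: power_int_mult_distrib power_int_mult power_int_numeral)
    moreover have "(w * z powi (-2) * p powi (-4 * r)) powi s = w powi s * z powi (-2 * s) * p powi ((-4 * r) * s)"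
      by (simp only: power_int_mult_distrib power_int_mult)
    moreover have "(p ^ 5) powi k = p powi (5 * k)" for k
      by (simp only: power_int_mult power_int_numeral)
    ultimately show ?thesis
      by (simp only: prod.case mult_ac)
  qed
  let ?S = "\<lambda>r. z powi r * p powi r\<^sup>2 *
    (theta (z * w\<^sup>2 * p powi (2 * r)) (p ^ 5) * theta (w * z powi (-2) * p powi (-4 * r)) (p ^ 5))"
  have fib: "((\<lambda>y. ?F (?g (r, y))) has_sum ?S r) UNIV" for r
  proof -
    let ?G = "\<lambda>(x, s). ((z * w\<^sup>2 * p powi (2 * r)) powi x * (p ^ 5) powi x\<^sup>2) *
      ((w * z powi (-2) * p powi (-4 * r)) powi s * (p ^ 5) powi s\<^sup>2)"
    have "(?G has_sum (theta (z * w\<^sup>2 * p powi (2 * r)) (p ^ 5) * theta (w * z powi (-2) * p powi (-4 * r)) (p ^ 5))) UNIV"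
      by (rule theta_product_has_sum) (use p nz in \<open>auto simp: power_less_one_iff\<close>)
    then have "((\<lambda>y. z powi r * p powi r\<^sup>2 * ?G y) has_sum ?S r) UNIV"
      by (rule has_sum_cmult_right)
    also have "(\<lambda>y. z powi r * p powi r\<^sup>2 * ?G y) = (\<lambda>y. ?F (?g (r, y)))"
    proof (rule ext)
      fix y show "z powi r * p powi r\<^sup>2 * ?G y = ?F (?g (r, y))"
      proof -
        obtain a b where y: "y = (a, b)" by (cases y)
        show ?thesis using term_eq[of r a b] unfolding y by (simp only: prod.case)
      qed
    qed
    finally show ?thesis .
  qed
  have "(?F has_sum (theta z p * theta w p)) UNIV"
    by (rule theta_product_has_sum[OF p p nz])
  moreover have "(?F has_sum (\<Sum>r\<in>{-2..2}. ?S r)) UNIV"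
    by (rule has_sum_finite_fibres[OF bij _ fib]) simp
  ultimately show ?thesis by (rule has_sum_unique)
qed

text \<open>
Here \<open>m + n\<i> = r + (x + s) + (x - s)\<i>\<close>, and \<open>r\<close> is the parity of \<open>m + n\<close>.
\<close>

lemma theta_product_2:
  fixes z w p :: real
  assumes p: "0 < p" "p < 1" and nz: "z \<noteq> 0" "w \<noteq> 0"
  shows "theta z p * theta w p = theta (z * w) (p\<^sup>2) * theta (z / w) (p\<^sup>2) +
     z * p * (theta (z * w * p\<^sup>2) (p\<^sup>2) * theta (z / w * p\<^sup>2) (p\<^sup>2))"
proof -
  let ?F = "\<lambda>(m::int, n::int). (z powi m * p powi m\<^sup>2) * (w powi n * p powi n\<^sup>2)"
  let ?g = "\<lambda>(r::int, x::int, s::int). (r + x + s, x - s)"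
  let ?i = "\<lambda>(m::int, n::int). let r = (m + n) mod 2 in (r, (m + n - r) div 2, (m - n - r) div 2)"
  have bij: "bij_betw ?g ({0,1} \<times> UNIV) UNIV"
  proof (rule bij_betwI[of _ _ _ ?i])
    show "?i \<in> UNIV \<rightarrow> {0,1} \<times> UNIV"
      by (auto simp: Let_def)
    show "?g (?i y) = y" if "y \<in> UNIV" for y
    proof -
      obtain m n where y: "y = (m, n)" by (cases y)
      define r where "r = (m + n) mod 2"
      define x where "x = (m + n - r) div 2"
      define s where "s = (m - n - r) div 2"
      define k where "k = (m + n) div 2"
      have "m + n = 2 * k + r"
        unfolding r_def k_def by simp
      then have "m + n - r = 2 * k" "m - n - r = 2 * (k - n)" by (simp_all add: algebra_simps)
      then have "m + n - r = 2 * x" "m - n - r = 2 * s"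
        unfolding x_def s_def by (simp_all only:) simp_all
      then have "r + x + s = m" "x - s = n" by simp_all
      then show ?thesis unfolding y by (simp add: Let_def x_def s_def r_def)
    qed
    show "?i (?g y) = y" if y: "y \<in> {0,1} \<times> UNIV" for y
    proof -
      obtain r x s where y: "y = (r, x, s)" "r = 0 \<or> r = 1" using y by (cases y) auto
      then have "r + x + s + (x - s) = r + 2 * x" "(r + 2 * x) mod 2 = r" by (auto simp: mod_mult_self2)
      moreover have "r + 2 * x - r = 2 * x" "r + x + s - (x - s) - r = 2 * s" by auto
      ultimately show ?thesis unfolding y by (simp only: Let_def prod.case) simp
    qed
  qed (auto)
  have term_eq: "?F (?g (r, x, s)) = z powi r * p powi r\<^sup>2 *
     (((z * w * p powi (2 * r)) powi x * (p\<^sup>2) powi x\<^sup>2) *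
      ((z / w * p powi (2 * r)) powi s * (p\<^sup>2) powi s\<^sup>2))" for r x s
  proof -
    have "(r + x + s)\<^sup>2 + (x - s)\<^sup>2 = r\<^sup>2 + (2 * r * x + (2 * x\<^sup>2 + ((2 * r) * s + 2 * s\<^sup>2)))"
      by (simp add: power2_eq_square algebra_simps)
    then have "p powi (r + x + s)\<^sup>2 * p powi (x - s)\<^sup>2 =
       p powi r\<^sup>2 * (p powi (2 * r * x) * (p powi (2 * x\<^sup>2) * (p powi ((2 * r) * s) * p powi (2 * s\<^sup>2))))"
      using p by (simp add: power_int_add[symmetric])
    moreover have "z powi (r + x + s) = z powi r * (z powi x * z powi s)"
      using nz by (simp add: power_int_add[symmetric] algebra_simps)
    moreover have "w powi (x - s) = w powi x / w powi s"
      using nz by (simp add: power_int_diff)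
    moreover have "(z * w * p powi (2 * r)) powi x = z powi x * w powi x * p powi (2 * r * x)"
      by (simp only: power_int_mult_distrib power_int_mult)
    moreover have "(z / w * p powi (2 * r)) powi s = z powi s / w powi s * p powi ((2 * r) * s)"
      by (simp only: power_int_mult_distrib power_int_divide_distrib power_int_mult)
    moreover have "(p\<^sup>2) powi k = p powi (2 * k)" for k
      by (simp only: power_int_mult power_int_numeral)
    ultimately show ?thesis
      by (simp only: prod.case divide_inverse mult_ac)
  qed
  let ?S = "\<lambda>r. z powi r * p powi r\<^sup>2 *
      (theta (z * w * p powi (2 * r)) (p\<^sup>2) * theta (z / w * p powi (2 * r)) (p\<^sup>2))"
  have fib: "((\<lambda>y. ?F (?g (r, y))) has_sum ?S r) UNIV" for r
  proof -
    let ?G = "\<lambda>(x, s). ((z * w * p powi (2 * r)) powi x * (p\<^sup>2) powi x\<^sup>2) *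
      ((z / w * p powi (2 * r)) powi s * (p\<^sup>2) powi s\<^sup>2)"
    have "(?G has_sum (theta (z * w * p powi (2 * r)) (p\<^sup>2) * theta (z / w * p powi (2 * r)) (p\<^sup>2))) UNIV"
      by (rule theta_product_has_sum) (use p nz in \<open>auto simp: power_less_one_iff\<close>)
    then have "((\<lambda>y. z powi r * p powi r\<^sup>2 * ?G y) has_sum ?S r) UNIV"
      by (rule has_sum_cmult_right)
    also have "(\<lambda>y. z powi r * p powi r\<^sup>2 * ?G y) = (\<lambda>y. ?F (?g (r, y)))"
    proof (rule ext)
      fix y show "z powi r * p powi r\<^sup>2 * ?G y = ?F (?g (r, y))"
      proof -
        obtain a b where y: "y = (a, b)" by (cases y)
        show ?thesis using term_eq[of r a b] unfolding y by (simp only: prod.case)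
      qed
    qed
    finally show ?thesis .
  qed
  have "(?F has_sum (theta z p * theta w p)) UNIV"
    by (rule theta_product_has_sum[OF p p nz])
  moreover have "(?F has_sum (\<Sum>r\<in>{0,1}. ?S r)) UNIV"
    by (rule has_sum_finite_fibres[OF bij _ fib]) simp
  ultimately have "theta z p * theta w p = (\<Sum>r\<in>{0,1}. ?S r)" by (rule has_sum_unique)
  then show ?thesis by simp
qed

section \<open>The Jacobi triple product\<close>

definition qfac :: "real \<Rightarrow> nat \<Rightarrow> real" where
  "qfac q n = (\<Prod>i<n. 1 - q ^ Suc i)"

text \<open>
Reciprocals of \<open>q\<close>-factorials, continued by 0 to negative integers as \<open>1/n!\<close> is. This convention
keeps the recurrence \<open>inv_qfac_pred\<close> valid for all integers, so that the Gaussian binomial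
coefficients below vanish outside their range without case distinctions.
\<close>

definition inv_qfac :: "real \<Rightarrow> int \<Rightarrow> real" where
  "inv_qfac q n = (if n < 0 then 0 else 1 / qfac q (nat n))"

lemma qfac_pos: "0 < q \<Longrightarrow> q < 1 \<Longrightarrow> 0 < qfac q n"
  unfolding qfac_def by (intro prod_pos) (auto simp: power_Suc_less_one simp del: power_Suc)

lemma inv_qfac_pred:
  assumes "0 < q" "q < 1"
  shows "inv_qfac q (n - 1) = (1 - q powi n) * inv_qfac q n"
proof (cases "n \<le> 0")
  case True
  then show ?thesis by (cases "n = 0") (auto simp: inv_qfac_def)
next
  case False
  then obtain k where k: "n = int (Suc k)"
    by (metis not_le pos_int_cases Suc_pred)
  have "q ^ Suc k < 1" using assms by (rule_tac power_Suc_less_one) auto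
  then have "1 - q ^ Suc k \<noteq> 0" by linarith
  moreover have "nat (int (Suc k) - 1) = k" "nat (int (Suc k)) = Suc k" "\<not> int (Suc k) - 1 < 0" "\<not> int (Suc k) < 0"
    by simp_all
  ultimately show ?thesis
    unfolding k power_int_of_nat inv_qfac_def by (simp only: if_False) (simp add: qfac_def del: power_Suc of_nat_Suc)
qed

text \<open>
Cauchy's finite form of the triple product; the coefficient is the Gaussian binomial coefficient
\<open>2N\<close> over \<open>N + j\<close> in the variable \<open>q\<^sup>2\<close>. As a function of \<open>z\<close>, the product gains the factor
\<open>1 + Q\<^sup>2 + Q(z + 1/z)\<close> with \<open>Q = q^(2N+1)\<close> when \<open>N\<close> grows by one, so that the coefficient of
\<open>z^j\<close> at \<open>N + 1\<close> comes from those of \<open>z^(j-1)\<close>, \<open>z^j\<close> and \<open>z^(j+1)\<close> at \<open>N\<close>.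
\<close>

lemma finite_triple_product:
  fixes q z :: real
  assumes q: "0 < q" "q < 1" and z: "z \<noteq> 0"
  shows "((\<lambda>j::int. qfac (q\<^sup>2) (2 * N) * inv_qfac (q\<^sup>2) (int N - j) * inv_qfac (q\<^sup>2) (int N + j)
            * (z powi j * q powi j\<^sup>2)) has_sum
          (\<Prod>k<N. (1 + z * q ^ (2 * k + 1)) * (1 + q ^ (2 * k + 1) / z))) UNIV"
    (is "((\<lambda>j. ?c N j * ?t j) has_sum ?P N) UNIV")
proof (induction N)
  case 0
  have "((\<lambda>j. ?c 0 j * ?t j) has_sum (\<Sum>j\<in>{0}. ?c 0 j * ?t j)) {0}"
    by (rule has_sum_finite) simp
  also have "?this \<longleftrightarrow> ((\<lambda>j. ?c 0 j * ?t j) has_sum (\<Sum>j\<in>{0}. ?c 0 j * ?t j)) UNIV"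
    by (rule has_sum_cong_neutral) (auto simp: inv_qfac_def)
  finally show ?case by (simp add: inv_qfac_def qfac_def)
next
  case (Suc N)
  define Q where "Q = q ^ (2 * N + 1)"
  have "((\<lambda>j. ?c N (j - 1) * ?t (j - 1)) has_sum ?P N) UNIV"
    by (subst has_sum_reindex_bij_witness[of _ "\<lambda>j. j + 1" "\<lambda>j. j - 1" UNIV "\<lambda>j. ?c N j * ?t j"])
       (use Suc in auto)
  moreover have "((\<lambda>j. ?c N (j + 1) * ?t (j + 1)) has_sum ?P N) UNIV"
    by (subst has_sum_reindex_bij_witness[of _ "\<lambda>j. j - 1" "\<lambda>j. j + 1" UNIV "\<lambda>j. ?c N j * ?t j"])
       (use Suc in auto)
  ultimately have "((\<lambda>j. (1 + Q\<^sup>2) * (?c N j * ?t j) + (Q * z * (?c N (j - 1) * ?t (j - 1)) +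
      Q / z * (?c N (j + 1) * ?t (j + 1)))) has_sum
      ((1 + Q\<^sup>2) * ?P N + (Q * z * ?P N + Q / z * ?P N))) UNIV"
    by (intro has_sum_add has_sum_cmult_right Suc)
  moreover have "(1 + Q\<^sup>2) * ?P N + (Q * z * ?P N + Q / z * ?P N) = ?P (Suc N)"
    using z unfolding prod.lessThan_Suc Q_def[symmetric]
    by (simp add: field_simps power2_eq_square)
  moreover have "(1 + Q\<^sup>2) * (?c N j * ?t j) + (Q * z * (?c N (j - 1) * ?t (j - 1)) +
      Q / z * (?c N (j + 1) * ?t (j + 1))) = ?c (Suc N) j * ?t j" for j
  proof -
    define p where "p = q\<^sup>2"
    define x where "x = p powi (int N + 1 - j)"
    define y where "y = p powi (int N + 1 + j)"
    define a where "a = inv_qfac p (int N + 1 - j)"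
    define b where "b = inv_qfac p (int N + 1 + j)"
    have p: "0 < p" "p < 1" using q by (auto simp: p_def power_less_one_iff)
    have a1: "inv_qfac p (int N - j) = (1 - x) * a"
      using inv_qfac_pred[OF p, of "int N + 1 - j"] unfolding x_def a_def by (simp add: algebra_simps)
    have b1: "inv_qfac p (int N + j) = (1 - y) * b"
      using inv_qfac_pred[OF p, of "int N + 1 + j"] unfolding y_def b_def by (simp add: algebra_simps)
    have px: "p powi (int N - j) = x / p" and py: "p powi (int N + j) = y / p"
      using p by (simp_all add: x_def y_def power_int_add power_int_diff)
    have a2: "inv_qfac p (int N - (j + 1)) = (1 - x / p) * ((1 - x) * a)"
      using inv_qfac_pred[OF p, of "int N - j"] unfolding px a1 by (simp add: algebra_simps)
    have b2: "inv_qfac p (int N + (j - 1)) = (1 - y / p) * ((1 - y) * b)"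
      using inv_qfac_pred[OF p, of "int N + j"] unfolding py b1 by (simp add: algebra_simps)
    have a0: "inv_qfac p (int N - (j - 1)) = a" "inv_qfac p (int (Suc N) - j) = a"
      and b0: "inv_qfac p (int N + (j + 1)) = b" "inv_qfac p (int (Suc N) + j) = b"
      by (simp_all add: a_def b_def algebra_simps)
    have xy: "x * y = p ^ (2 * N + 2)"
    proof -
      have "x * y = p powi (int (2 * N + 2))"
        using p unfolding x_def y_def by (simp add: power_int_add[symmetric] add.commute)
      then show ?thesis by (simp only: power_int_of_nat)
    qed
    have xyp: "x * y / p = p ^ (2 * N + 1)"
      using xy p by (simp add: field_simps)
    have Q2: "Q\<^sup>2 = x * y / p"
    proof -
      have "Q\<^sup>2 = p ^ (2 * N + 1)"
        by (simp only: Q_def p_def power_mult[symmetric] mult.commute)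
      then show ?thesis using xyp by simp
    qed
    have qf: "qfac p (2 * Suc N) = qfac p (2 * N) * (1 - x * y / p) * (1 - x * y)"
      unfolding xyp xy by (simp add: qfac_def)
    have tm: "Q * z * ?t (j - 1) = x * ?t j"
    proof -
      have "Q * q powi (j - 1)\<^sup>2 = q powi (int (2 * N + 1) + (j - 1)\<^sup>2)"
        using q unfolding Q_def by (subst power_int_add) (auto simp only: power_int_of_nat)
      also have "\<dots> = q powi (2 * (int N + 1 - j) + j\<^sup>2)"
        by (rule arg_cong[of _ _ "\<lambda>n. q powi n"]) (simp add: power2_eq_square algebra_simps)
      also have "\<dots> = x * q powi j\<^sup>2"
        using q by (simp add: power_int_add x_def p_def power_int_power)
      finally have "Q * q powi (j - 1)\<^sup>2 = x * q powi j\<^sup>2" .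
      moreover have "z * z powi (j - 1) = z powi j"
        using z by (simp add: power_int_diff)
      ultimately show ?thesis
        by (metis (no_types, lifting) mult.assoc mult.left_commute)
    qed
    have tp: "Q / z * ?t (j + 1) = y * ?t j"
    proof -
      have "Q * q powi (j + 1)\<^sup>2 = q powi (int (2 * N + 1) + (j + 1)\<^sup>2)"
        using q unfolding Q_def by (subst power_int_add) (auto simp only: power_int_of_nat)
      also have "\<dots> = q powi (2 * (int N + 1 + j) + j\<^sup>2)"
        by (rule arg_cong[of _ _ "\<lambda>n. q powi n"]) (simp add: power2_eq_square algebra_simps)
      also have "\<dots> = y * q powi j\<^sup>2"
        using q by (simp add: power_int_add y_def p_def power_int_power)
      finally have 1: "Q * q powi (j + 1)\<^sup>2 = y * q powi j\<^sup>2" .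
      have 2: "z powi (j + 1) / z = z powi j"
        using z by (simp add: power_int_add)
      have "Q / z * ?t (j + 1) = (z powi (j + 1) / z) * (Q * q powi (j + 1)\<^sup>2)" by simp
      then show ?thesis unfolding 1 2 by simp
    qed
    \<comment> \<open>Since \<open>Q\<^sup>2 = x y / p\<close>, this is the recurrence of the Gaussian binomial coefficients.\<close>
  have key: "(1 + x * y / p) * ((1 - x) * (1 - y)) + x * ((1 - y / p) * (1 - y)) + y * ((1 - x / p) * (1 - x))
        = (1 - x * y / p) * (1 - x * y)"
      using p by (simp add: field_simps)
    have "(1 + Q\<^sup>2) * (?c N j * ?t j) + (Q * z * (?c N (j - 1) * ?t (j - 1)) +
      Q / z * (?c N (j + 1) * ?t (j + 1))) =
      (1 + Q\<^sup>2) * (?c N j * ?t j) + (?c N (j - 1) * (Q * z * ?t (j - 1)) +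
      ?c N (j + 1) * (Q / z * ?t (j + 1)))" by (simp add: mult_ac)
    also have "\<dots> = qfac p (2 * N) * a * b * ?t j * ((1 + x * y / p) * ((1 - x) * (1 - y)) +
        x * ((1 - y / p) * (1 - y)) + y * ((1 - x / p) * (1 - x)))"
      unfolding tm tp Q2 p_def[symmetric] a1 b1 a2 b2 a0 b0
      by (simp add: algebra_simps add_divide_distrib diff_divide_distrib)
    also have "\<dots> = ?c (Suc N) j * ?t j"
      unfolding key p_def[symmetric] qf a0 b0 by simp
    finally show ?thesis .
  qed
  ultimately show ?case by simp
qed

lemma convergent_prod_one_plus_geometric:
  fixes a q :: real
  assumes "\<bar>q\<bar> < 1"
  shows "convergent_prod (\<lambda>n. 1 + a * q ^ n)"
proof -
  have "summable (\<lambda>n. \<bar>a\<bar> * \<bar>q\<bar> ^ n)"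
    using assms by (intro summable_mult summable_geometric) auto
  then have "abs_convergent_prod (\<lambda>n. 1 + a * q ^ n)"
    by (simp add: abs_convergent_prod_conv_summable abs_mult power_abs)
  then show ?thesis by (rule abs_convergent_prod_imp_convergent_prod)
qed

text \<open>
In Cauchy's finite form all coefficients tend to the reciprocal of \<open>D = (q\<^sup>2; q\<^sup>2)\<^sub>\<infinity>\<close> and are
bounded by \<open>1/D\<^sup>2\<close>, so Tannery's theorem permits to take the limit termwise.
\<close>

theorem jacobi_triple_product:
  fixes q z :: real
  assumes q: "0 < q" "q < 1" and z: "z \<noteq> 0"
  shows "theta z q = (\<Prod>k. 1 + z * q ^ (2 * k + 1)) * (\<Prod>k. 1 + q ^ (2 * k + 1) / z) * (\<Prod>k. 1 - q ^ (2 * k + 2))"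
proof -
  define p where "p = q\<^sup>2"
  have p: "0 < p" "p < 1" using q by (auto simp: p_def power_less_one_iff)
  define D where "D = (\<Prod>k. 1 - q ^ (2 * k + 2))"
  have Df: "(\<lambda>k. 1 - q ^ (2 * k + 2)) = (\<lambda>k. 1 - p ^ Suc k)"
    by (simp add: p_def power_mult[symmetric] power_add[symmetric] flip: power_Suc) 
  have pk: "0 < p ^ Suc k" "p ^ Suc k < 1" for k
    using p by (auto simp: power_Suc_less_one simp del: power_Suc)
  have conv: "convergent_prod (\<lambda>k. 1 - p ^ Suc k)"
    using convergent_prod_one_plus_geometric[of p "- p"] p by simp
  have Dpos: "0 < D"
    unfolding D_def Df using pk by (intro less_0_prodinf conv) auto
  have qD: "(\<lambda>n. qfac p n) \<longlonglongrightarrow> D"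
    using convergent_prod_LIMSEQ[OF conv] unfolding qfac_def D_def Df by (simp only: LIMSEQ_lessThan_iff_atMost)
  have Dle: "D \<le> qfac p n" for n
    unfolding qfac_def D_def Df
    by (rule prod_ge_prodinf[OF convergent_prod_has_prod[OF conv]])
       (use pk in \<open>auto simp: less_imp_le simp del: power_Suc\<close>)
  have qle: "qfac p n \<le> 1" for n
    unfolding qfac_def by (rule prod_le_1) (use pk in \<open>auto simp: less_imp_le simp del: power_Suc\<close>)
  have inv_le: "inv_qfac p j \<le> 1 / D" "0 \<le> inv_qfac p j" for j
    using Dpos Dle[of "nat j"] by (auto simp: inv_qfac_def intro!: divide_left_mono mult_pos_pos)
  define c where "c = (\<lambda>N j. qfac p (2 * N) * inv_qfac p (int N - j) * inv_qfac p (int N + j))"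
  define t where "t = (\<lambda>j. z powi j * q powi j\<^sup>2)"
  have inv_lim: "(\<lambda>N. inv_qfac p (int N + j)) \<longlonglongrightarrow> 1 / D" for j
  proof -
    have "filterlim (\<lambda>N. nat (int N + j)) at_top sequentially"
      by (rule filterlim_at_top_mono[OF filterlim_minus_const_nat_at_top[of "nat \<bar>j\<bar>"]]) (rule always_eventually, arith)
    then have "(\<lambda>N. 1 / qfac p (nat (int N + j))) \<longlonglongrightarrow> 1 / D"
      using Dpos by (intro tendsto_divide tendsto_const filterlim_compose[OF qD]) auto
    moreover have "eventually (\<lambda>N. 1 / qfac p (nat (int N + j)) = inv_qfac p (int N + j)) sequentially"
      using eventually_ge_at_top[of "nat \<bar>j\<bar>"] by eventually_elim (auto simp: inv_qfac_def)
    ultimately show ?thesis by (rule Lim_transform_eventually)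
  qed
  have c_lim: "(\<lambda>N. c N j) \<longlonglongrightarrow> 1 / D" for j
  proof -
    have "filterlim (\<lambda>N::nat. 2 * N) at_top sequentially"
      by (rule mult_nat_left_at_top) simp
    then have "(\<lambda>N. qfac p (2 * N)) \<longlonglongrightarrow> D"
      by (rule filterlim_compose[OF qD])
    then have "(\<lambda>N. c N j) \<longlonglongrightarrow> D * (1 / D) * (1 / D)"
      unfolding c_def using inv_lim[of j] inv_lim[of "- j"] by (intro tendsto_mult) auto
    then show ?thesis using Dpos by simp
  qed
  have c_le: "\<bar>c N j\<bar> \<le> 1 / D * (1 / D)" for N j
  proof -
    have "0 \<le> qfac p (2 * N)" using qfac_pos[OF p] by (simp add: less_imp_le)
    then have "\<bar>c N j\<bar> = c N j" unfolding c_def using inv_le by simp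
    also have "\<dots> \<le> 1 * (1 / D) * (1 / D)"
      unfolding c_def using inv_le qle \<open>0 \<le> qfac p (2 * N)\<close> Dpos by (intro mult_mono) auto
    finally show ?thesis by simp
  qed
  have t_summ: "t summable_on UNIV"
    unfolding t_def by (rule theta_summable[OF q z])
  have tann: "(\<lambda>N. \<Sum>n. c N (g n) * t (g n)) \<longlonglongrightarrow> (\<Sum>n. 1 / D * t (g n))"
    if "summable (\<lambda>n. \<bar>t (g n)\<bar>)" for g :: "nat \<Rightarrow> int"
  proof -
    have "(\<lambda>N. c N (g n) * t (g n)) \<longlonglongrightarrow> 1 / D * t (g n)" for n
      by (intro tendsto_mult c_lim tendsto_const)
    moreover have "eventually (\<lambda>(n, N). norm (c N (g n) * t (g n)) \<le> 1 / D * (1 / D) * \<bar>t (g n)\<bar>)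
        (at_top \<times>\<^sub>F sequentially)"
      using c_le by (intro always_eventually) (auto simp: abs_mult intro!: mult_right_mono simp del: times_divide_eq_left times_divide_eq_right)
    moreover have "summable (\<lambda>n. 1 / D * (1 / D) * \<bar>t (g n)\<bar>)"
      by (intro summable_mult that)
    ultimately show ?thesis
      using tannerys_theorem[of "\<lambda>n N. c N (g n) * t (g n)" "\<lambda>n. 1 / D * t (g n)" sequentially
          "\<lambda>n. 1 / D * (1 / D) * \<bar>t (g n)\<bar>"] by auto
  qed
  have abs_t: "(\<lambda>j. \<bar>t j\<bar>) summable_on UNIV"
    using t_summ summable_on_iff_abs_summable_on_real[of t UNIV] by simp
  have s1: "summable (\<lambda>n. \<bar>t (int n)\<bar>)" and s2: "summable (\<lambda>n. \<bar>t (- int n - 1)\<bar>)"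
    using infsum_int_split(1,2)[OF abs_t] by auto
  have P: "(\<Prod>k<N. (1 + z * q ^ (2 * k + 1)) * (1 + q ^ (2 * k + 1) / z)) =
      (\<Sum>n. c N (int n) * t (int n)) + (\<Sum>n. c N (- int n - 1) * t (- int n - 1))" for N
  proof -
    have hs: "((\<lambda>j. c N j * t j) has_sum (\<Prod>k<N. (1 + z * q ^ (2 * k + 1)) * (1 + q ^ (2 * k + 1) / z))) UNIV"
      unfolding c_def t_def p_def by (rule finite_triple_product[OF q z])
    show ?thesis
      using infsum_int_split(3)[OF has_sum_imp_summable[OF hs]] infsumI[OF hs] by simp
  qed
  have "(\<lambda>N. \<Prod>k<N. (1 + z * q ^ (2 * k + 1)) * (1 + q ^ (2 * k + 1) / z)) \<longlonglongrightarrow>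
      (\<Sum>n. 1 / D * t (int n)) + (\<Sum>n. 1 / D * t (- int n - 1))"
    unfolding P by (intro tendsto_add tann s1 s2)
  also have "(\<Sum>n. 1 / D * t (int n)) + (\<Sum>n. 1 / D * t (- int n - 1)) = theta z q / D"
    using infsum_int_split[OF t_summ] unfolding theta_def t_def[symmetric]
    by (simp add: suminf_mult suminf_divide add_divide_distrib)
  finally have lim1: "(\<lambda>N. \<Prod>k<N. (1 + z * q ^ (2 * k + 1)) * (1 + q ^ (2 * k + 1) / z)) \<longlonglongrightarrow> theta z q / D" .
  have cA: "convergent_prod (\<lambda>k. 1 + z * q ^ (2 * k + 1))"
    using convergent_prod_one_plus_geometric[of p "z * q"] p by (simp add: p_def power_mult mult.assoc)
  have cB: "convergent_prod (\<lambda>k. 1 + q ^ (2 * k + 1) / z)"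
    using convergent_prod_one_plus_geometric[of p "q / z"] p by (simp add: p_def power_mult mult.assoc)
  have "(\<lambda>N. (\<Prod>k<N. 1 + z * q ^ (2 * k + 1)) * (\<Prod>k<N. 1 + q ^ (2 * k + 1) / z)) \<longlonglongrightarrow>
      (\<Prod>k. 1 + z * q ^ (2 * k + 1)) * (\<Prod>k. 1 + q ^ (2 * k + 1) / z)"
    using convergent_prod_LIMSEQ[OF cA] convergent_prod_LIMSEQ[OF cB]
    by (intro tendsto_mult) (simp_all only: LIMSEQ_lessThan_iff_atMost)
  then have "theta z q / D = (\<Prod>k. 1 + z * q ^ (2 * k + 1)) * (\<Prod>k. 1 + q ^ (2 * k + 1) / z)"
    using lim1 by (intro LIMSEQ_unique[OF lim1]) (simp add: prod.distrib)
  then show ?thesis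
    using Dpos unfolding D_def by (simp add: field_simps)
qed

section \<open>Products with exponents depending on the part\<close>

text \<open>
With the exponents given as a function, multiplying such products amounts to adding functions, and
identities between products reduce to pointwise identities between exponents.
\<close>

definition euler_product :: "(nat \<Rightarrow> nat) \<Rightarrow> real \<Rightarrow> real" where
  "euler_product e t = (\<Prod>k. (1 - t ^ Suc k) ^ e (Suc k))"

text \<open>
A bound on the exponents suffices, since \<open>1 - (1 - x)^n\<close> is at most \<open>n x\<close> by Bernoulli's inequality.
\<close>

lemma euler_product_convergent:
  fixes t :: real
  assumes "0 < t" "t < 1" "\<And>k. e k \<le> M"
  shows "convergent_prod (\<lambda>k. (1 - t ^ Suc k) ^ e (Suc k))"
proof -
  have "summable (\<lambda>k. norm ((1 - t ^ Suc k) ^ e (Suc k) - 1))"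
  proof (rule summable_comparison_test)
    show "\<exists>N. \<forall>k\<ge>N. norm (norm ((1 - t ^ Suc k) ^ e (Suc k) - 1)) \<le> real M * t * t ^ k"
    proof (intro exI[of _ 0] allI impI)
      fix k
      have t1: "0 < t ^ Suc k" "t ^ Suc k < 1"
        using assms by (auto simp: power_Suc_less_one simp del: power_Suc)
      have "1 + real (e (Suc k)) * (- (t ^ Suc k)) \<le> (1 + (- (t ^ Suc k))) ^ e (Suc k)"
        by (rule Bernoulli_inequality) (use t1 in linarith)
      moreover have "(1 - t ^ Suc k) ^ e (Suc k) \<le> 1"
        by (rule power_le_one) (use t1 in auto)
      moreover have "real (e (Suc k)) * t ^ Suc k \<le> real M * t ^ Suc k"
        using assms(3) t1 by (intro mult_right_mono) auto
      ultimately show "norm (norm ((1 - t ^ Suc k) ^ e (Suc k) - 1)) \<le> real M * t * t ^ k"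
        by simp
    qed
    show "summable (\<lambda>k. real M * t * t ^ k)"
      using assms by (intro summable_mult summable_geometric) auto
  qed
  then have "abs_convergent_prod (\<lambda>k. (1 - t ^ Suc k) ^ e (Suc k))"
    by (simp add: abs_convergent_prod_conv_summable)
  then show ?thesis by (rule abs_convergent_prod_imp_convergent_prod)
qed

lemma euler_product_factor:
  fixes t :: real
  assumes "0 < t" "t < 1"
  shows "0 < (1 - t ^ Suc k) ^ n" "(1 - t ^ Suc k) ^ n \<le> 1"
proof -
  have "0 < t ^ Suc k" "t ^ Suc k < 1"
    using assms by (auto simp: power_Suc_less_one simp del: power_Suc)
  then show "0 < (1 - t ^ Suc k) ^ n" "(1 - t ^ Suc k) ^ n \<le> 1"
    by (auto intro!: power_le_one simp del: power_Suc)
qed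

lemma euler_product_LIMSEQ:
  fixes t :: real
  assumes "0 < t" "t < 1" "\<And>k. e k \<le> M"
  shows "(\<lambda>K. \<Prod>k<K. (1 - t ^ Suc k) ^ e (Suc k)) \<longlonglongrightarrow> euler_product e t"
  using convergent_prod_LIMSEQ[OF euler_product_convergent[OF assms]]
  unfolding euler_product_def by (simp only: LIMSEQ_lessThan_iff_atMost)

lemma euler_product_pos:
  fixes t :: real
  assumes "0 < t" "t < 1" "\<And>k. e k \<le> M"
  shows "0 < euler_product e t"
  unfolding euler_product_def using euler_product_factor[OF assms(1,2)] euler_product_convergent[OF assms]
  by (intro less_0_prodinf) auto

lemma euler_product_le_partial:
  fixes t :: real
  assumes "0 < t" "t < 1" "\<And>k. e k \<le> M"
  shows "euler_product e t \<le> (\<Prod>k<K. (1 - t ^ Suc k) ^ e (Suc k))"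
  unfolding euler_product_def
  by (rule prod_ge_prodinf[OF convergent_prod_has_prod[OF euler_product_convergent[OF assms]]])
     (use euler_product_factor[OF assms(1,2)] in \<open>auto simp: less_imp_le simp del: power_Suc\<close>)

lemma euler_product_add:
  fixes t :: real
  assumes "0 < t" "t < 1" "\<And>k. e k \<le> M" "\<And>k. e' k \<le> M"
  shows "euler_product (\<lambda>k. e k + e' k) t = euler_product e t * euler_product e' t"
  unfolding euler_product_def power_add
  by (rule prodinf_mult[symmetric]; rule euler_product_convergent[OF assms(1,2)]; rule assms)

lemma prodinf_arith_progression:
  fixes t :: real
  assumes t: "0 < t" "t < 1" and m: "a < m"
  shows "(\<Prod>n. 1 - t ^ (m * n + Suc a)) = euler_product (\<lambda>k. if k mod m = Suc a mod m then 1 else 0) t"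
    (is "_ = euler_product ?e t")
proof -
  let ?g = "\<lambda>k. (1 - t ^ Suc k) ^ ?e (Suc k)"
  have block: "prod ?g {n * m..<n * m + m} = 1 - t ^ (m * n + Suc a)" for n
  proof -
    have "prod ?g {n * m..<n * m + m} = prod ?g {n * m + a}"
    proof (rule prod.mono_neutral_right)
      show "\<forall>i\<in>{n * m..<n * m + m} - {n * m + a}. ?g i = 1"
      proof
        fix i assume i: "i \<in> {n * m..<n * m + m} - {n * m + a}"
        then obtain j where j: "i = n * m + j" "j < m" "j \<noteq> a"
          by (metis Diff_iff add_less_cancel_left atLeastLessThan_iff insertI1 le_Suc_ex)
        have "Suc i mod m = Suc j mod m"
          unfolding j by (metis add_Suc_right mod_mult_self3)
        moreover have "Suc j mod m \<noteq> Suc a mod m"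
          using j m by (auto simp: mod_Suc)
        ultimately show "?g i = 1" by simp
      qed
    qed (use m in auto)
    also have "\<dots> = 1 - t ^ (m * n + Suc a)"
    proof -
      have "Suc (n * m + a) mod m = Suc a mod m"
        by (metis add_Suc_right mod_mult_self3)
      then show ?thesis by (simp add: mult.commute)
    qed
    finally show ?thesis .
  qed
  have "(\<Prod>n<N. 1 - t ^ (m * n + Suc a)) = prod ?g {..<N * m}" for N
    unfolding block[symmetric] by (rule prod.nat_group)
  moreover have "(\<lambda>N. prod ?g {..<N * m}) \<longlonglongrightarrow> euler_product ?e t"
    using filterlim_compose[OF euler_product_LIMSEQ[OF t, of ?e 1], of "\<lambda>N. N * m" sequentially]
      mult_nat_right_at_top[of m] m by simp
  moreover have "0 < euler_product ?e t"
    by (rule euler_product_pos[OF t, of _ 1]) simp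
  ultimately show ?thesis
    by (intro prodinf_eq_prod_lim') (simp_all only: less_irrefl not_False_eq_True neq_iff simp_thms)
qed

section \<open>Generating functions of flavoured partitions\<close>

definition weight :: "(nat \<times> nat) multiset \<Rightarrow> nat" where
  "weight P = (\<Sum>(k, c)\<in>#P. k)"

lemma weight_simps [simp]: "weight {#} = 0" "weight (P + Q) = weight P + weight Q"
    "weight (replicate_mset n x) = n * fst x"
  by (simp_all add: weight_def case_prod_beta)

text \<open>
A multiset over \<open>insert x X\<close> is a multiplicity of \<open>x\<close> together with a multiset over \<open>X\<close>, which
contributes a geometric series as a further factor.
\<close>

lemma has_sum_multisets_finite:
  fixes t :: real
  assumes t: "0 < t" "t < 1" and "finite X" "\<And>x. x \<in> X \<Longrightarrow> 0 < fst x"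
  shows "((\<lambda>P. t ^ weight P) has_sum (\<Prod>x\<in>X. 1 / (1 - t ^ fst x))) {P. set_mset P \<subseteq> X}"
  using assms(3,4)
proof (induction X)
  case empty
  have "((\<lambda>P. t ^ weight P) has_sum (\<Sum>P\<in>{{#}}. t ^ weight P)) {{#}}"
    by (rule has_sum_finite) simp
  then show ?case by simp
next
  case (insert x X)
  have x: "\<bar>t ^ fst x\<bar> < 1"
    using insert.prems[of x] t by (simp add: power_less_one_iff)
  have "summable (\<lambda>n. norm (t ^ fst x) ^ n)"
    by (rule summable_geometric) (use x in \<open>simp only: real_norm_def abs_idempotent\<close>)
  then have "summable (\<lambda>n. norm ((t ^ fst x) ^ n))"
    by (simp only: norm_power)
  moreover have "(\<lambda>n. (t ^ fst x) ^ n) sums (1 / (1 - t ^ fst x))"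
    by (rule geometric_sums) (use x in simp)
  ultimately have "((\<lambda>n. (t ^ fst x) ^ n) has_sum (1 / (1 - t ^ fst x))) UNIV"
    by (rule norm_summable_imp_has_sum)
  then have "((\<lambda>(n, P). (t ^ fst x) ^ n * t ^ weight P) has_sum
      (1 / (1 - t ^ fst x) * (\<Prod>x\<in>X. 1 / (1 - t ^ fst x)))) (UNIV \<times> {P. set_mset P \<subseteq> X})"
    by (rule has_sum_product_real) (use insert in auto)
  also have "?this \<longleftrightarrow> ((\<lambda>P. t ^ weight P) has_sum (\<Prod>x\<in>insert x X. 1 / (1 - t ^ fst x)))
      {P. set_mset P \<subseteq> insert x X}"
  proof (rule has_sum_reindex_bij_witness[of _ "\<lambda>P. (count P x, filter_mset (\<lambda>y. y \<noteq> x) P)"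
        "\<lambda>(n, P). replicate_mset n x + P"])
    fix y assume y: "y \<in> (UNIV :: nat set) \<times> {P. set_mset P \<subseteq> X}"
    obtain n P where [simp]: "y = (n, P)" and P: "set_mset P \<subseteq> X" using y by auto
    have x0: "count P x = 0" using P insert.hyps by (auto simp: count_eq_zero_iff)
    have "filter_mset (\<lambda>y. y \<noteq> x) (replicate_mset n x + P) = P"
    proof (rule multiset_eqI)
      fix y show "count (filter_mset (\<lambda>y. y \<noteq> x) (replicate_mset n x + P)) y = count P y"
        using x0 by (cases "y = x") simp_all
    qed
    moreover have "count (replicate_mset n x + P) x = n" using x0 by simp
    ultimately show "(count (case y of (n, P) \<Rightarrow> replicate_mset n x + P) x,
         filter_mset (\<lambda>y. y \<noteq> x) (case y of (n, P) \<Rightarrow> replicate_mset n x + P)) = y"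
      by (simp only: \<open>y = (n, P)\<close> prod.case)
    have "set_mset (replicate_mset n x) \<subseteq> {x}" by (simp add: set_mset_replicate_mset_subset)
    then show "(case y of (n, P) \<Rightarrow> replicate_mset n x + P) \<in> {P. set_mset P \<subseteq> insert x X}"
      using P by (simp add: subset_insertI2)
    show "t ^ weight (case y of (n, P) \<Rightarrow> replicate_mset n x + P) =
        (case y of (n, P) \<Rightarrow> (t ^ fst x) ^ n * t ^ weight P)"
      by (simp add: power_add power_mult[symmetric] mult.commute)
  next
    fix P assume "P \<in> {P. set_mset P \<subseteq> insert x X}"
    then show "(count P x, filter_mset (\<lambda>y. y \<noteq> x) P) \<in> UNIV \<times> {P. set_mset P \<subseteq> X}" by auto
    show "(case (count P x, filter_mset (\<lambda>y. y \<noteq> x) P) of (n, P) \<Rightarrow> replicate_mset n x + P) = P"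
      by (simp add: multiset_eq_iff)
  qed (use insert.hyps in auto)
  finally show ?case .
qed

text \<open>
All terms being nonnegative, the sum over all partitions is the limit of the sums over the
partitions with parts of size at most \<open>K\<close>. Summability also yields that there are only
finitely many partitions of \<open>n\<close>: infinitely many would contribute the same positive term \<open>t^n\<close> each.
\<close>

theorem flavoured_partitions_gf:
  fixes t :: real and S :: "nat set"
  assumes t: "0 < t" "t < 1" and M: "\<And>k. k \<in> S \<Longrightarrow> flav k \<le> M"
  defines "e \<equiv> (\<lambda>k. if k \<in> S then flav k else 0)"
  shows "(\<lambda>n. real (num_partitions S flav n) * t ^ n) sums (1 / euler_product e t)"
proof -
  define parts where "parts = (\<lambda>K. SIGMA k:{1..K}. {..<e k})"
  define all where "all = {P. \<forall>(k, c) \<in># P. 0 < k \<and> c < e k}"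
  have mem: "P \<in> flavoured_partitions S flav n \<longleftrightarrow> P \<in> all \<and> weight P = n" for P n
  proof -
    have "(0 < k \<and> k \<in> S \<and> c < flav k) = (0 < k \<and> c < e k)" for k c
      by (simp add: e_def)
    then show ?thesis
      unfolding flavoured_partitions_def all_def weight_def by simp
  qed
  have eM: "e k \<le> M" for k using M by (simp add: e_def)
  have ep: "0 < euler_product e t" by (rule euler_product_pos[where e = e, OF t eM])
  have parts: "((\<lambda>P. t ^ weight P) has_sum (1 / (\<Prod>k<K. (1 - t ^ Suc k) ^ e (Suc k)))) {P. set_mset P \<subseteq> parts K}" for K
  proof -
    have "(\<Prod>x\<in>parts K. 1 / (1 - t ^ fst x)) = (\<Prod>k\<in>{1..K}. \<Prod>c<e k. 1 / (1 - t ^ k))"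
      unfolding parts_def by (subst prod.Sigma) (auto simp: case_prod_beta)
    also have "\<dots> = (\<Prod>k<K. 1 / (1 - t ^ Suc k) ^ e (Suc k))"
      by (simp add: power_one_over prod.atLeast1_atMost_eq del: power_Suc)
    also have "\<dots> = 1 / (\<Prod>k<K. (1 - t ^ Suc k) ^ e (Suc k))"
      by (simp add: prod_dividef)
    finally show ?thesis
      using has_sum_multisets_finite[OF t, of "parts K"] by (auto simp: parts_def)
  qed
  have sub: "{P. set_mset P \<subseteq> parts K} \<subseteq> all" for K
    by (auto simp: parts_def all_def)
  have le: "sum (\<lambda>P. t ^ weight P) F \<le> 1 / euler_product e t" if F: "finite F" "F \<subseteq> all" for F
  proof -
    define K where "K = Max (insert 0 (\<Union>P\<in>F. fst ` set_mset P))"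
    have "F \<subseteq> {P. set_mset P \<subseteq> parts K}"
    proof (intro subsetI CollectI)
      fix P x assume P: "P \<in> F" and x: "x \<in># P"
      have "fst x \<le> K" unfolding K_def
        using F(1) P x by (intro Max_ge) auto
      then show "x \<in> parts K"
        using F(2) P x by (cases x) (force simp: parts_def all_def)
    qed
    then have "sum (\<lambda>P. t ^ weight P) F \<le> 1 / (\<Prod>k<K. (1 - t ^ Suc k) ^ e (Suc k))"
      by (intro finite_sum_le_has_sum[OF parts]) (use F t in auto)
    also have "\<dots> \<le> 1 / euler_product e t"
      using euler_product_le_partial[where e = e and K = K, OF t eM] ep by (intro divide_left_mono mult_pos_pos order_less_le_trans[OF ep]) simp_all
    finally show ?thesis .
  qed
  have summ: "(\<lambda>P. t ^ weight P) summable_on all"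
    by (rule nonneg_bdd_above_summable_on) (use t le in \<open>auto intro!: bdd_aboveI2[of _ _ "1 / euler_product e t"]\<close>)
  have "infsum (\<lambda>P. t ^ weight P) all \<le> 1 / euler_product e t"
    by (rule infsum_le_finite_sums[OF summ]) (use le in auto)
  moreover have "1 / euler_product e t \<le> infsum (\<lambda>P. t ^ weight P) all"
  proof (rule LIMSEQ_le_const2)
    show "(\<lambda>K. 1 / (\<Prod>k<K. (1 - t ^ Suc k) ^ e (Suc k))) \<longlonglongrightarrow> 1 / euler_product e t"
      using ep by (intro tendsto_divide tendsto_const euler_product_LIMSEQ[where e = e, OF t eM]) auto
    show "\<exists>N. \<forall>K\<ge>N. 1 / (\<Prod>k<K. (1 - t ^ Suc k) ^ e (Suc k)) \<le> infsum (\<lambda>P. t ^ weight P) all"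
      using has_sum_mono2[OF parts has_sum_infsum[OF summ] sub] t by auto
  qed
  ultimately have "((\<lambda>P. t ^ weight P) has_sum (1 / euler_product e t)) all"
    using has_sum_infsum[OF summ] by simp
  also have "?this \<longleftrightarrow> ((\<lambda>(n, P). t ^ n) has_sum (1 / euler_product e t)) (SIGMA n:UNIV. flavoured_partitions S flav n)"
    by (rule has_sum_reindex_bij_witness[of _ snd "\<lambda>P. (weight P, P)"])
       (auto simp: mem)
  finally have sig: "((\<lambda>(n, P). t ^ n) has_sum (1 / euler_product e t)) (SIGMA n:UNIV. flavoured_partitions S flav n)" .
  have fin: "finite (flavoured_partitions S flav n)" for n
  proof (rule ccontr)
    assume "infinite (flavoured_partitions S flav n)"
    moreover have "(\<lambda>P. t ^ n) summable_on flavoured_partitions S flav n"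
      using summable_on_SigmaD1[of "\<lambda>n P. t ^ n" UNIV "flavoured_partitions S flav" n]
        has_sum_imp_summable[OF sig] by simp
    ultimately show False
      using infsum_diverge_constant[of "flavoured_partitions S flav n" "t ^ n"] t by auto
  qed
  have "((\<lambda>n. real (num_partitions S flav n) * t ^ n) has_sum (1 / euler_product e t)) UNIV"
  proof (rule has_sum_Sigma'[OF sig])
    fix n
    show "((\<lambda>P. case (n, P) of (n, P) \<Rightarrow> t ^ n) has_sum real (num_partitions S flav n) * t ^ n)
        (flavoured_partitions S flav n)"
      using has_sum_finite[OF fin, of "\<lambda>_. t ^ n" n] by (simp add: num_partitions_def)
  qed
  then show ?thesis by (rule has_sum_imp_sums)
qed

lemma sums_quotient_flavoured:
  fixes t :: real and S :: "nat set"
  assumes t: "0 < t" "t < 1" and eq: "\<And>k. (if k \<in> S then flav k else 0) + e k = e' k" and M: "\<And>k. e' k \<le> M"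
  shows "(\<lambda>n. real (num_partitions S flav n) * t ^ n) sums (euler_product e t / euler_product e' t)"
proof -
  have le: "(if k \<in> S then flav k else 0) \<le> M" "e k \<le> M" for k
    using eq[of k] M[of k] by linarith+
  have "e' = (\<lambda>k. (if k \<in> S then flav k else 0) + e k)" using eq by auto
  then have "euler_product e' t = euler_product (\<lambda>k. if k \<in> S then flav k else 0) t * euler_product e t"
    using euler_product_add[OF t le] by simp
  moreover have "0 < euler_product e t" by (rule euler_product_pos[OF t le(2)])
  ultimately have "1 / euler_product (\<lambda>k. if k \<in> S then flav k else 0) t = euler_product e t / euler_product e' t" by simp
  moreover have "flav k \<le> M" if "k \<in> S" for k using le(1)[of k] that by simp
  ultimately show ?thesis
    using flavoured_partitions_gf[OF t, of S flav M] by simp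
qed

section \<open>Theta series as products over residue classes\<close>

definition on_class :: "nat \<Rightarrow> nat \<Rightarrow> nat \<Rightarrow> nat" where
  "on_class m a k = of_bool (k mod m = a mod m)"

lemma prodinf_on_class:
  fixes t :: real
  assumes "0 < t" "t < 1" "0 < a" "a \<le> m"
  shows "(\<Prod>n. 1 - t ^ (m * n + a)) = euler_product (on_class m a) t"
proof -
  obtain c where c: "a = Suc c" using assms(3) by (cases a) auto
  have "on_class m a = (\<lambda>k. if k mod m = Suc c mod m then 1 else 0)"
    by (auto simp: on_class_def c fun_eq_iff)
  then show ?thesis
    using prodinf_arith_progression[OF assms(1,2), of c m] assms(4) c by simp
qed

text \<open>
The exponents of \<open>1 - t^k\<close> in the triple product \<open>f(-t^a, -t^(m-a))\<close>.
\<close>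

definition triple_class :: "nat \<Rightarrow> nat \<Rightarrow> nat \<Rightarrow> nat" where
  "triple_class m a k = on_class m a k + on_class m (m - a) k + on_class m m k"

text \<open>
The triple product in the variable \<open>s\<^sup>2\<close>. The sign \<open>\<sigma>\<close> is \<open>1\<close> for the given products with factors
\<open>1 + q^k\<close> and \<open>-1\<close> elsewhere; the hypothesis on \<open>z\<close> states \<open>z = s^(a - b)\<close> without
negative exponents.
\<close>

lemma theta_prodinf:
  fixes s z \<sigma> :: real
  assumes s: "0 < s" "s < 1" and z: "z * s ^ b = s ^ a" and \<sigma>: "\<sigma> * \<sigma> = 1" and ab: "0 < a + b"
  shows "theta (\<sigma> * z) (s ^ (a + b)) = (\<Prod>k. 1 + \<sigma> * (s\<^sup>2) ^ ((a + b) * k + a)) *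
    (\<Prod>k. 1 + \<sigma> * (s\<^sup>2) ^ ((a + b) * k + b)) * (\<Prod>k. 1 - (s\<^sup>2) ^ ((a + b) * k + (a + b)))"
proof -
  have z0: "z \<noteq> 0" using z s by auto
  have \<sigma>0: "\<sigma> \<noteq> 0" using \<sigma> by auto
  have m: "0 < s ^ (a + b)" "s ^ (a + b) < 1" using s ab by (auto simp: power_less_one_iff)
  have "(s ^ (a + b)) ^ (2 * k + 1) = s ^ b * s ^ (a + 2 * ((a + b) * k))" for k
    by (simp add: power_mult[symmetric] power_add[symmetric] algebra_simps)
  then have 1: "\<sigma> * z * (s ^ (a + b)) ^ (2 * k + 1) = \<sigma> * (s\<^sup>2) ^ ((a + b) * k + a)" for k
  proof -
    have "\<sigma> * z * (s ^ (a + b)) ^ (2 * k + 1) = \<sigma> * ((z * s ^ b) * s ^ (a + 2 * ((a + b) * k)))"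
      by (simp only: \<open>\<And>k. (s ^ (a + b)) ^ (2 * k + 1) = _ k\<close> mult.assoc)
    also have "\<dots> = \<sigma> * s ^ (2 * ((a + b) * k + a))"
      unfolding z power_add[symmetric] by (simp add: algebra_simps)
    finally show ?thesis by (simp only: power_mult)
  qed
  have "(s ^ (a + b)) ^ (2 * k + 1) / (\<sigma> * z) = \<sigma> * (s\<^sup>2) ^ ((a + b) * k + b)" for k
  proof -
    have "\<sigma> * (s\<^sup>2) ^ ((a + b) * k + b) * (\<sigma> * z) = (\<sigma> * \<sigma>) * ((z * s ^ b) * s ^ (b + 2 * ((a + b) * k)))"
      by (simp add: power_mult[symmetric] power_add[symmetric] algebra_simps)
    also have "\<dots> = s ^ (a + (b + 2 * ((a + b) * k)))"
      unfolding z \<sigma> by (simp add: power_add)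
    also have "\<dots> = (s ^ (a + b)) ^ (2 * k + 1)"
      by (simp add: power_mult[symmetric] power_add[symmetric] algebra_simps)
    finally show ?thesis using z0 \<sigma>0 by (simp add: divide_eq_eq)
  qed
  moreover have "(s ^ (a + b)) ^ (2 * k + 2) = (s\<^sup>2) ^ ((a + b) * k + (a + b))" for k
    by (simp add: power_mult[symmetric] power_add[symmetric] algebra_simps)
  moreover have "theta (\<sigma> * z) (s ^ (a + b)) = (\<Prod>k. 1 + \<sigma> * z * (s ^ (a + b)) ^ (2 * k + 1)) *
      (\<Prod>k. 1 + (s ^ (a + b)) ^ (2 * k + 1) / (\<sigma> * z)) * (\<Prod>k. 1 - (s ^ (a + b)) ^ (2 * k + 2))"
    by (rule jacobi_triple_product[OF m]) (use z0 \<sigma>0 in simp)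
  ultimately show ?thesis
    by (simp only: 1)
qed

lemma euler_product_add3:
  fixes t :: real
  assumes t: "0 < t" "t < 1" and "\<And>k. e1 k \<le> M" "\<And>k. e2 k \<le> M" "\<And>k. e3 k \<le> M"
  shows "euler_product (\<lambda>k. e1 k + e2 k + e3 k) t = euler_product e1 t * euler_product e2 t * euler_product e3 t"
proof -
  have "euler_product (\<lambda>k. (e1 k + e2 k) + e3 k) t = euler_product (\<lambda>k. e1 k + e2 k) t * euler_product e3 t"
    by (rule euler_product_add[OF t, of _ "M + M"]) (use assms in \<open>auto intro: add_mono trans_le_add1\<close>)
  also have "euler_product (\<lambda>k. e1 k + e2 k) t = euler_product e1 t * euler_product e2 t"
    by (rule euler_product_add[OF t assms(3,4)])
  finally show ?thesis .
qed

lemma on_class_le [simp]: "on_class m a k \<le> Suc 0"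
  by (simp add: on_class_def)

lemma theta_minus_euler_product:
  fixes s z :: real
  assumes s: "0 < s" "s < 1" and z: "z * s ^ b = s ^ a" and ab: "0 < a" "0 < b" and m: "m = a + b"
  shows "theta (- z) (s ^ m) = euler_product (triple_class m b) (s\<^sup>2)"
proof -
  have t: "0 < s\<^sup>2" "s\<^sup>2 < 1" using s by (auto simp: power_less_one_iff)
  have "theta (- z) (s ^ m) = (\<Prod>k. 1 - (s\<^sup>2) ^ (m * k + a)) * (\<Prod>k. 1 - (s\<^sup>2) ^ (m * k + b)) * (\<Prod>k. 1 - (s\<^sup>2) ^ (m * k + m))"
    using theta_prodinf[OF s z, of "- 1"] ab unfolding m by simp
  also have "\<dots> = euler_product (on_class m a) (s\<^sup>2) * euler_product (on_class m b) (s\<^sup>2) * euler_product (on_class m m) (s\<^sup>2)"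
    using ab m by (simp add: prodinf_on_class[OF t])
  also have "\<dots> = euler_product (\<lambda>k. on_class m a k + on_class m b k + on_class m m k) (s\<^sup>2)"
    by (rule euler_product_add3[OF t, where M = "Suc 0", symmetric]) (rule on_class_le)+
  also have "(\<lambda>k. on_class m a k + on_class m b k + on_class m m k) = triple_class m b"
    by (simp add: triple_class_def m add.commute fun_eq_iff)
  finally show ?thesis .
qed

section \<open>Two representations of a product of Euler factors\<close>

lemma residues_mod_15:
  fixes k :: nat
  shows "\<exists>j\<in>{0,1,2,3,4,5,6,7,8,9,10,11,12,13,14}. k mod 15 = j \<and> k mod 5 = j mod 5 \<and> k mod 3 = j mod 3"
proof -
  have "j \<in> {0,1,2,3,4,5,6,7,8,9,10,11,12,13,14}" if "j < 15" for j :: nat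
    using that
    by (simp add: lessThan_iff[symmetric] lessThan_nat_numeral lessThan_Suc del: lessThan_iff) (elim disjE, simp_all)
  from this[of "k mod 15"] show ?thesis
    by (intro bexI[of _ "k mod 15"]) (simp_all add: mod_mod_cancel)
qed

text \<open>
\<open>f(-t^2, -t^3) f(-t, -t^4) = (t)\<^sub>1 (t)\<^sub>5\<close> with \<open>t = s\<^sup>2\<close>: both products contain \<open>1 - t^k\<close> twice if 5
divides \<open>k\<close>, and once otherwise. The Euler factors appear as triple products, which
is the pentagonal number theorem.
\<close>

lemma euler_factor_5:
  fixes s :: real
  assumes s: "0 < s" "s < 1"
  shows "theta (- s) (s ^ 5) * theta (- (s ^ 3)) (s ^ 5) = theta (- s) (s ^ 3) * theta (- (s ^ 5)) (s ^ 15)"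
proof -
  have t: "0 < s\<^sup>2" "s\<^sup>2 < 1" using s by (auto simp: power_less_one_iff)
  have 1: "theta (- s) (s ^ 5) = euler_product (triple_class 5 2) (s\<^sup>2)"
    by (rule theta_minus_euler_product[OF s, of _ _ 3]) (simp_all add: eval_nat_numeral)
  have 2: "theta (- (s ^ 3)) (s ^ 5) = euler_product (triple_class 5 1) (s\<^sup>2)"
    by (rule theta_minus_euler_product[OF s, of _ _ 4]) (simp_all add: eval_nat_numeral)
  have 3: "theta (- s) (s ^ 3) = euler_product (triple_class 3 1) (s\<^sup>2)"
    by (rule theta_minus_euler_product[OF s, of _ _ 2]) (simp_all add: eval_nat_numeral)
  have 4: "theta (- (s ^ 5)) (s ^ 15) = euler_product (triple_class 15 5) (s\<^sup>2)"
    by (rule theta_minus_euler_product[OF s, of _ _ 10]) (simp_all add: eval_nat_numeral)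
  have le: "triple_class m a k \<le> 3" for m a k
    unfolding triple_class_def
    using on_class_le[of m a k] on_class_le[of m "m - a" k] on_class_le[of m m k] by linarith
  have "triple_class 5 2 k + triple_class 5 1 k = triple_class 3 1 k + triple_class 15 5 k" for k
  proof -
    obtain j where j: "j \<in> {0,1,2,3,4,5,6,7,8,9,10,11,12,13,14}" and k: "k mod 15 = j" "k mod 5 = j mod 5" "k mod 3 = j mod 3"
      using residues_mod_15[of k] by (elim bexE conjE) (rule that)
    from j show ?thesis
      unfolding triple_class_def on_class_def k by (elim insertE emptyE; simp)
  qed
  then show ?thesis
    unfolding 1 2 3 4 by (simp only: euler_product_add[OF t le le, symmetric])
qed

text \<open>
Both sides evaluate the sum of \<open>H (j, x) = (-1)^x t^(j\<^sup>2 + j - x j + x(3x-1)/2)\<close> over the plane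
lattice. With \<open>v = 2j + 1 - x\<close> the exponent is \<open>(v\<^sup>2 + 5x\<^sup>2 - 1)/4\<close>, and splitting by the parity of
\<open>x\<close> gives the left hand side. For the right hand side the lattice is split by \<open>j\<close> modulo 3: the
pentagonal double series has the form \<open>3(m\<^sup>2 + 5n\<^sup>2)/2\<close>, and multiplication by \<open>1 - \<surd>-5\<close>, of norm 6,
maps \<open>m + n\<surd>-5\<close> onto the class of \<open>j = 0\<close>, up to a shift of the centre. The class of \<open>j = 2\<close> is its image under \<open>v + x\<surd>-5 \<mapsto> -(v + x\<surd>-5)\<close>, and the class
of \<open>j = 1\<close> admits an involution that preserves the exponent and changes the parity of \<open>x\<close>.
\<close>

theorem theta_euler_product:
  fixes s :: real
  assumes s: "0 < s" "s < 1"
  defines "t \<equiv> s\<^sup>2"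
  shows "theta t t * theta 1 (t ^ 5) - t * (theta 1 t * theta (t ^ 5) (t ^ 5)) =
    2 * (theta (- s) (s ^ 3) * theta (- (s ^ 5)) (s ^ 15))"
proof -
  define E where "E = (\<lambda>j x :: int. 2 * j\<^sup>2 + 2 * j - 2 * x * j + 3 * x\<^sup>2 - x)"
  define H where "H = (\<lambda>(j, x). (-1) powi x * s powi E j x)"
  have t: "0 < t" "t < 1" "t ^ 5 < 1" "0 < t ^ 5" using s by (auto simp: t_def power_less_one_iff)
  have tp: "t powi k = s powi (2 * k)" "(t ^ 5) powi k = s powi (10 * k)" for k
    by (simp_all add: t_def power_int_power)
  have pw: "(s ^ 3) powi k = s powi (3 * k)" "(s ^ 15) powi k = s powi (15 * k)" "(s ^ 5) powi k = s powi (5 * k)" for k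
    by (simp_all add: power_int_power)
  have neg: "(- c) powi k = (-1) powi k * c powi k" for c :: real and k :: int
    by (metis mult_minus1 power_int_mult_distrib)
  let ?g = "\<lambda>(r::int, m::int, n::int). (m + n, 2 * n + r)"
  let ?i = "\<lambda>(j::int, x::int). (x mod 2, j - x div 2, x div 2)"
  have bij1: "bij_betw ?g ({0,1} \<times> UNIV) UNIV"
    by (rule bij_betwI[of _ _ _ ?i]) (auto simp: algebra_simps)
  have even: "((\<lambda>y. H (?g (0, y))) has_sum (theta t t * theta 1 (t ^ 5))) UNIV"
  proof -
    have "H (?g (0, m, n)) = (t powi m * t powi m\<^sup>2) * (1 powi n * (t ^ 5) powi n\<^sup>2)" for m n
    proof -
      have "E (m + n) (2 * n) = 2 * m + (2 * m\<^sup>2 + 10 * n\<^sup>2)"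
        by (simp add: E_def power2_eq_square algebra_simps)
      then have "s powi E (m + n) (2 * n) = t powi m * (t powi m\<^sup>2 * (t ^ 5) powi n\<^sup>2)"
        using s by (simp only: tp) (simp add: power_int_add)
      then show ?thesis
        unfolding H_def by simp
    qed
    then have "(\<lambda>y. H (?g (0, y))) = (\<lambda>(m, n). (t powi m * t powi m\<^sup>2) * (1 powi n * (t ^ 5) powi n\<^sup>2))"
      by (auto simp: fun_eq_iff)
    then show ?thesis
      using theta_product_has_sum[of t "t ^ 5" t 1] t by simp
  qed
  have odd: "((\<lambda>y. H (?g (1, y))) has_sum (- t * (theta 1 t * theta (t ^ 5) (t ^ 5)))) UNIV"
  proof -
    have "H (?g (1, m, n)) = - t * ((1 powi m * t powi m\<^sup>2) * ((t ^ 5) powi n * (t ^ 5) powi n\<^sup>2))" for m n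
    proof -
      have "E (m + n) (2 * n + 1) = 2 + (2 * m\<^sup>2 + (10 * n + 10 * n\<^sup>2))"
        by (simp add: E_def power2_eq_square algebra_simps)
      then have "s powi E (m + n) (2 * n + 1) = t * (t powi m\<^sup>2 * ((t ^ 5) powi n * (t ^ 5) powi n\<^sup>2))"
        using s by (simp only: tp) (simp add: power_int_add t_def)
      then show ?thesis
        unfolding H_def by simp
    qed
    then have "(\<lambda>y. H (?g (1, y))) = (\<lambda>y. - t * (case y of (m, n) \<Rightarrow> (1 powi m * t powi m\<^sup>2) * ((t ^ 5) powi n * (t ^ 5) powi n\<^sup>2)))"
      by (auto simp: fun_eq_iff)
    then show ?thesis
      using has_sum_cmult_right[OF theta_product_has_sum[of t "t ^ 5" 1 "t ^ 5"], of "- t"] t by simp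
  qed
  have "(H has_sum (\<Sum>r\<in>{0,1::int}. if r = 0 then theta t t * theta 1 (t ^ 5) else - t * (theta 1 t * theta (t ^ 5) (t ^ 5)))) UNIV"
    by (rule has_sum_finite_fibres[OF bij1]) (use even odd in auto)
  then have sum1: "(H has_sum (theta t t * theta 1 (t ^ 5) - t * (theta 1 t * theta (t ^ 5) (t ^ 5)))) UNIV"
    by simp
  let ?J = "theta (- s) (s ^ 3) * theta (- (s ^ 5)) (s ^ 15)"
  let ?h = "\<lambda>(r::int, m::int, n::int). if r = 0 then (3 * n, n - m) else if r = 1 then (3 * n + 1, m)
     else (- 1 - 3 * n, m - n)"
  let ?k = "\<lambda>(j::int, x::int). if j mod 3 = 0 then (0, j div 3 - x, j div 3) else if j mod 3 = 1 then (1, x, j div 3)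
     else (2, x + (- 1 - j) div 3, (- 1 - j) div 3)"
  have bij2: "bij_betw ?h ({0,1,2} \<times> UNIV) UNIV"
  proof (rule bij_betwI[of _ _ _ ?k])
    show "?k \<in> UNIV \<rightarrow> {0,1,2} \<times> UNIV" by auto
    show "?k (?h y) = y" if "y \<in> {0,1,2} \<times> UNIV" for y
    proof -
      have 1: "(- 1 - 3 * n) mod 3 = (2::int)" "(3 * n + 1) mod 3 = 1" "(3 * n + 1) div 3 = n" for n :: int
        by presburger+
      show ?thesis using that by (auto simp: 1)
    qed
    show "?h (?k y) = y" if "y \<in> UNIV" for y
    proof -
      obtain j x where y: "y = (j, x)" by (cases y)
      consider n where "j = 3 * n" | n where "j = 3 * n + 1" | n where "j = - 1 - 3 * n"
      proof -
        have "j = 3 * (j div 3) \<or> j = 3 * (j div 3) + 1 \<or> j = - 1 - 3 * (- (j div 3) - 1)" by presburger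
        then show thesis using that by blast
      qed
      then show ?thesis
      proof cases
        case 3
        have "(- 1 - 3 * n) mod 3 = (2::int)" for n :: int by presburger
        then show ?thesis unfolding y 3 by simp
      qed (auto simp: y)
    qed
  qed auto
  have class0: "((\<lambda>y. H (?h (0, y))) has_sum ?J) UNIV"
  proof -
    have "H (?h (0, m, n)) = ((- s) powi m * (s ^ 3) powi m\<^sup>2) * ((- (s ^ 5)) powi n * (s ^ 15) powi n\<^sup>2)" for m n
    proof -
      have "E (3 * n) (n - m) = m + (3 * m\<^sup>2 + (5 * n + 15 * n\<^sup>2))"
        by (simp add: E_def power2_eq_square algebra_simps)
      then have "s powi E (3 * n) (n - m) =
          s powi m * ((s ^ 3) powi m\<^sup>2 * ((s ^ 5) powi n * (s ^ 15) powi n\<^sup>2))"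
        using s by (simp only: pw) (simp add: power_int_add)
      moreover have "(-1) powi (n - m) = (-1) powi m * ((-1) powi n :: real)"
        by (simp add: power_int_diff power_int_minus_left)
      ultimately show ?thesis
        unfolding H_def neg[of s] neg[of "s ^ 5"] by simp
    qed
    then have "(\<lambda>y. H (?h (0, y))) = (\<lambda>(m, n). ((- s) powi m * (s ^ 3) powi m\<^sup>2) * ((- (s ^ 5)) powi n * (s ^ 15) powi n\<^sup>2))"
      by (auto simp: fun_eq_iff)
    then show ?thesis
      using theta_product_has_sum[of "s ^ 3" "s ^ 15" "- s" "- (s ^ 5)"] s by (simp add: power_less_one_iff)
  qed
  have class2: "((\<lambda>y. H (?h (2, y))) has_sum ?J) UNIV"
  proof -
    have "H (?h (2, m, n)) = H (?h (0, m, n))" for m n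
    proof -
      have "E (- 1 - 3 * n) (m - n) = E (3 * n) (n - m)"
        by (simp add: E_def power2_eq_square algebra_simps)
      moreover have "(-1) powi (m - n) = ((-1) powi (n - m) :: real)"
        by (rule power_int_minus_one_diff_commute)
      ultimately show ?thesis unfolding H_def by simp
    qed
    then have "(\<lambda>y. H (?h (2, y))) = (\<lambda>y. H (?h (0, y)))"
      by (auto simp: fun_eq_iff simp del: if_False)
    then show ?thesis using class0 by simp
  qed
  have class1: "((\<lambda>y. H (?h (1, y))) has_sum 0) UNIV"
  proof -
    \<comment> \<open>For \<open>j = 3n + 1\<close> the exponent depends on \<open>x\<close> only through \<open>x (x - (2n + 1))\<close>.\<close>
    have inv: "H (?h (1, 2 * n + 1 - m, n)) = - H (?h (1, m, n))" for m n
    proof -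
      have "E (3 * n + 1) (2 * n + 1 - m) = E (3 * n + 1) m"
        by (simp add: E_def power2_eq_square algebra_simps)
      moreover have "(-1) powi (2 * n + 1 - m) = - ((-1) powi m :: real)"
        by (simp add: power_int_minus_left)
      ultimately show ?thesis unfolding H_def by simp
    qed
    have summ: "(\<lambda>y. H (?h (1, y))) summable_on UNIV"
    proof -
      have "(\<lambda>y. H (?h y)) summable_on ({0,1,2} \<times> UNIV)"
        using summable_on_reindex_bij_betw[OF bij2, of H] has_sum_imp_summable[OF sum1] by simp
      then have "(\<lambda>y. H (?h y)) summable_on (Pair 1 ` UNIV)"
        by (rule summable_on_subset_banach) auto
      then show ?thesis by (subst (asm) summable_on_reindex) (auto simp: inj_on_def o_def)
    qed
    have "(\<Sum>\<^sub>\<infinity>y. H (?h (1, y))) = (\<Sum>\<^sub>\<infinity>y. - H (?h (1, y)))"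
      by (rule infsum_reindex_bij_witness[of _ "\<lambda>(m, n). (2 * n + 1 - m, n)" "\<lambda>(m, n). (2 * n + 1 - m, n)"])
         (use inv in \<open>auto simp del: if_False\<close>)
    then have "(\<Sum>\<^sub>\<infinity>y. H (?h (1, y))) = 0"
      by (simp add: infsum_uminus)
    then show ?thesis using has_sum_infsum[OF summ] by simp
  qed
  have "(H has_sum (\<Sum>r\<in>{0,1,2::int}. if r = 1 then 0 else ?J)) UNIV"
    by (rule has_sum_finite_fibres[OF bij2]) (use class0 class1 class2 in auto)
  then have "(H has_sum (2 * ?J)) UNIV" by simp
  with sum1 show ?thesis by (rule has_sum_unique)
qed

section \<open>Theta series with base \<open>t^5\<close> and the squares of two triple products\<close>

text \<open>
Ramanujan's \<open>f(t^(5+k), t^(5-k))\<close> and, below, \<open>f(-t^(5+k), -t^(5-k))\<close>;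
indices \<open>k\<close> range over the integers because the dissections produce indices outside \<open>0, ..., 5\<close>.
\<close>

definition theta5 :: "real \<Rightarrow> int \<Rightarrow> real" where "theta5 t k = theta (t powi k) (t ^ 5)"
definition theta5_neg :: "real \<Rightarrow> int \<Rightarrow> real" where "theta5_neg t k = theta (- (t powi k)) (t ^ 5)"

lemma theta5_minus: "t \<noteq> 0 \<Longrightarrow> theta5 t (- k) = theta5 t k"
  unfolding theta5_def by (simp add: power_int_minus theta_inverse)

lemma theta5_neg_minus: "t \<noteq> 0 \<Longrightarrow> theta5_neg t (- k) = theta5_neg t k"
  using theta_inverse[of "- (t powi k)" "t ^ 5"] unfolding theta5_neg_def by (simp add: power_int_minus)

lemma theta5_add_10:
  assumes "0 < t"
  shows "theta5 t (k + 10) = theta5 t k / t powi (k + 5)"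
  using theta_shift[of "t ^ 5" "t powi k"] assms
  by (simp add: theta5_def power_int_add power_mult[symmetric])

lemma theta5_neg_add_10:
  assumes "0 < t"
  shows "theta5_neg t (k + 10) = - theta5_neg t k / t powi (k + 5)"
  using theta_shift[of "t ^ 5" "- (t powi k)"] assms
  by (simp add: theta5_neg_def power_int_add power_mult[symmetric])

lemma theta5_reduce:
  assumes "0 < t"
  shows "theta5 t 6 = theta5 t 4 / t" "theta5 t 7 = theta5 t 3 / t ^ 2" "theta5 t 8 = theta5 t 2 / t ^ 3" "theta5 t 9 = theta5 t 1 / t ^ 4"
    "theta5 t (- 1) = theta5 t 1" "theta5 t (- numeral n) = theta5 t (numeral n)"
  using theta5_add_10[OF assms, of "-4"] theta5_add_10[OF assms, of "-3"] theta5_add_10[OF assms, of "-2"]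
    theta5_add_10[OF assms, of "-1"] assms by (simp_all add: theta5_minus)

lemma theta5_neg_reduce:
  assumes "0 < t"
  shows "theta5_neg t 5 = 0" "theta5_neg t 7 = - theta5_neg t 3 / t ^ 2" "theta5_neg t 9 = - theta5_neg t 1 / t ^ 4"
    "theta5_neg t (- 1) = theta5_neg t 1" "theta5_neg t (- numeral n) = theta5_neg t (numeral n)"
  using theta5_neg_add_10[OF assms, of "-3"] theta5_neg_add_10[OF assms, of "-1"] theta_neg_zero[of "t ^ 5"] assms
  by (simp_all add: theta5_neg_minus) (simp add: theta5_neg_def)

lemma sum_minus2_2: "(\<Sum>r\<in>{-2..2::int}. f r) = f (-2) + f (-1) + f 0 + f 1 + (f 2 :: real)"
proof -
  have "{-2..2::int} = {-2, -1, 0, 1, 2}" by auto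
  then show ?thesis by (simp add: add.assoc)
qed

text \<open>
The classes of \<open>r = 1, -1, 2, -2\<close> modulo \<open>1 + 2\<i>\<close> are permuted by multiplication with \<open>\<i>\<close>,
hence they contribute equally.
\<close>

lemma phi_square_identity:
  assumes t: "0 < t" "t < 1"
  shows "(theta 1 t)\<^sup>2 - (theta5 t 0)\<^sup>2 = 4 * t * theta5 t 2 * theta5 t 4"
proof -
  have "theta 1 t * theta 1 t = (\<Sum>r\<in>{-2..2::int}. t powi r\<^sup>2 * (theta5 t (2 * r) * theta5 t (- 4 * r)))"
    using theta_product_5[OF t, of 1 1] by (simp add: theta5_def)
  also have "\<dots> = (theta5 t 0)\<^sup>2 + 4 * t * theta5 t 2 * theta5 t 4"
    using t unfolding sum_minus2_2
    by (simp add: theta5_reduce power2_eq_square eval_nat_numeral)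
  finally show ?thesis by (simp add: power2_eq_square)
qed

text \<open>
The counterpart of \<open>phi_square_identity\<close> for the lattice shifted by \<open>(1 + \<i>)/2\<close>. Rotation about the
centre fixes one class, that of \<open>r = 1\<close>, which yields the square, and permutes the other four.
\<close>

lemma psi_square_identity:
  assumes t: "0 < t" "t < 1"
  shows "(theta t t)\<^sup>2 - t\<^sup>2 * (theta5 t 5)\<^sup>2 = 4 * theta5 t 1 * theta5 t 3"
proof -
  have e1: "t * t\<^sup>2 * t powi (2 * r) = t powi (3 + 2 * r)" for r
    using t by (simp add: power_int_add power2_eq_square eval_nat_numeral)
  have e2: "t * t powi (-2) * t powi (-4 * r) = t powi (-1 + -4 * r)" for r
  proof -
    have "t powi (-1 + -4 * r) = t powi (1 + (-2) + -4 * r)" by simp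
    also have "\<dots> = t powi 1 * t powi (-2) * t powi (-4 * r)"
      using t by (simp only: power_int_add[OF disjI1] less_imp_neq[symmetric] not_False_eq_True)
    finally show ?thesis by simp
  qed
  have "theta t t * theta t t = (\<Sum>r\<in>{-2..2::int}. t powi r * t powi r\<^sup>2 * (theta5 t (3 + 2 * r) * theta5 t (-1 + -4 * r)))"
    using theta_product_5[OF t, of t t] t unfolding e1 e2 by (simp add: theta5_def)
  also have "\<dots> = t\<^sup>2 * (theta5 t 5)\<^sup>2 + 4 * theta5 t 1 * theta5 t 3"
    using t unfolding sum_minus2_2
    by (simp add: theta5_reduce power_int_minus_divide power2_eq_square eval_nat_numeral)
  finally show ?thesis by (simp add: power2_eq_square)
qed

lemma theta_square_split:
  fixes s :: real
  assumes s: "0 < s" "s < 1" and z: "z \<noteq> 0"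
  shows "(theta z s)\<^sup>2 = theta (z\<^sup>2) (s\<^sup>2) * theta 1 (s\<^sup>2) + z * s * (theta (z\<^sup>2 * s\<^sup>2) (s\<^sup>2) * theta (s\<^sup>2) (s\<^sup>2))"
  using theta_product_2[OF s z z] z by (simp add: power2_eq_square)

text \<open>
The splitting by parity, applied to the factors \<open>E\<^sub>1 = theta (- s) (s ^ 5)\<close> and
\<open>E\<^sub>2 = theta (- (s ^ 3)) (s ^ 5)\<close>. It gives representations that involve \<open>theta5 t 0\<close> and
\<open>theta5 t 5\<close>, i.e. \<open>\<Phi>\<close> and \<open>\<Psi>\<close> at \<open>t^5\<close>, in the place where the dissections have \<open>\<Phi>\<close> and \<open>\<Psi>\<close> at \<open>t\<close>.
\<close>

lemma pentagonal_squares: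
  fixes s :: real
  assumes s: "0 < s" "s < 1"
  defines "t \<equiv> s\<^sup>2"
  shows "(theta (- s) (s ^ 5))\<^sup>2 = theta5 t 1 * theta5 t 0 - t ^ 2 * theta5 t 4 * theta5 t 5"
    and "(theta (- (s ^ 3)) (s ^ 5))\<^sup>2 = theta5 t 3 * theta5 t 0 - t * theta5 t 2 * theta5 t 5"
    and "theta (- s) (s ^ 5) * theta (- (s ^ 3)) (s ^ 5) = theta5 t 1 * theta5 t 2 - t * theta5 t 3 * theta5 t 4"
proof -
  have t: "0 < t" using s by (simp add: t_def)
  have s5: "0 < s ^ 5" "s ^ 5 < 1" using s by (auto simp: power_less_one_iff)
  have e: "(s ^ 5)\<^sup>2 = t ^ 5" by (simp add: t_def power_mult[symmetric])
  have T: "theta (s ^ 2) (t ^ 5) = theta5 t 1" "theta (s ^ 6) (t ^ 5) = theta5 t 3" "theta (s ^ 4) (t ^ 5) = theta5 t 2"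
     "theta 1 (t ^ 5) = theta5 t 0" "theta (t ^ 5) (t ^ 5) = theta5 t 5"
     "theta (s ^ 12) (t ^ 5) = theta5 t 6" "theta (s ^ 16) (t ^ 5) = theta5 t 8" "theta (s ^ 14) (t ^ 5) = theta5 t 7"
    by (simp_all add: theta5_def t_def power_mult[symmetric])
  have "(theta (- s) (s ^ 5))\<^sup>2 = theta (s ^ 2) (t ^ 5) * theta 1 (t ^ 5) + - (s ^ 6) * (theta (s ^ 12) (t ^ 5) * theta (t ^ 5) (t ^ 5))"
    using theta_square_split[OF s5, of "- s"] s unfolding e[symmetric]
    by (simp add: power_mult[symmetric] power_add[symmetric] power_Suc[symmetric] del: power_Suc)
  also have "\<dots> = theta5 t 1 * theta5 t 0 - t ^ 2 * theta5 t 4 * theta5 t 5"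
    using t s unfolding T theta5_reduce[OF t] by (simp add: t_def field_simps eval_nat_numeral)
  finally show "(theta (- s) (s ^ 5))\<^sup>2 = theta5 t 1 * theta5 t 0 - t ^ 2 * theta5 t 4 * theta5 t 5" .
  have "(theta (- (s ^ 3)) (s ^ 5))\<^sup>2 = theta (s ^ 6) (t ^ 5) * theta 1 (t ^ 5) + - (s ^ 8) * (theta (s ^ 16) (t ^ 5) * theta (t ^ 5) (t ^ 5))"
    using theta_square_split[OF s5, of "- (s ^ 3)"] s unfolding e[symmetric]
    by (simp add: power_mult[symmetric] power_add[symmetric])
  also have "\<dots> = theta5 t 3 * theta5 t 0 - t * theta5 t 2 * theta5 t 5"
    using t s unfolding T theta5_reduce[OF t] by (simp add: t_def field_simps eval_nat_numeral)
  finally show "(theta (- (s ^ 3)) (s ^ 5))\<^sup>2 = theta5 t 3 * theta5 t 0 - t * theta5 t 2 * theta5 t 5" .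
  have "theta (- (s ^ 3)) (s ^ 5) * theta (- s) (s ^ 5) =
     theta (s ^ 4) (t ^ 5) * theta (s ^ 2) (t ^ 5) + - (s ^ 8) * (theta (s ^ 14) (t ^ 5) * theta (s ^ 12) (t ^ 5))"
  proof -
    have "s ^ 3 / s = s ^ 2" using s by (simp add: eval_nat_numeral)
    then have "- (s ^ 3) / - s = s ^ 2" by simp
    moreover have "- (s ^ 3) * - s = s ^ 4" "- (s ^ 3) * s ^ 5 = - (s ^ 8)" "s ^ 4 * (s ^ 5)\<^sup>2 = s ^ 14" "s ^ 2 * (s ^ 5)\<^sup>2 = s ^ 12"
      by (simp_all add: eval_nat_numeral)
    ultimately show ?thesis
      using theta_product_2[OF s5, of "- (s ^ 3)" "- s"] s unfolding e[symmetric] by simp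
  qed
  also have "\<dots> = theta5 t 1 * theta5 t 2 - t * theta5 t 3 * theta5 t 4"
    using t s unfolding T theta5_reduce[OF t] by (simp add: t_def field_simps eval_nat_numeral)
  finally show "theta (- s) (s ^ 5) * theta (- (s ^ 3)) (s ^ 5) = theta5 t 1 * theta5 t 2 - t * theta5 t 3 * theta5 t 4"
    by (simp add: mult.commute)
qed

lemma theta5_pos: "0 < t \<Longrightarrow> t < 1 \<Longrightarrow> 0 < theta5 t k"
  unfolding theta5_def by (intro theta_pos) (auto simp: power_less_one_iff)

text \<open>
Let \<open>X, Y\<close> be the difference and the sum of \<open>\<Phi>\<close> at \<open>t\<close> and at \<open>t^5\<close>, and \<open>U, V\<close> those of \<open>\<Psi>\<close> at \<open>t\<close>
and \<open>t\<close> times \<open>\<Psi>\<close> at \<open>t^5\<close>. The products \<open>X Y\<close> and \<open>U V\<close> are known, and so is \<open>Y U - X V\<close>, by comparing the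
two expressions for \<open>E\<^sub>1 E\<^sub>2\<close>. Thus \<open>Y U\<close> and \<open>- X V\<close> are the roots of a quadratic polynomial, which
also has the roots \<open>4 \<theta>\<^sub>1 \<theta>\<^sub>2 > 0\<close> and \<open>- 4 t \<theta>\<^sub>3 \<theta>\<^sub>4 < 0\<close> with \<open>\<theta>\<^sub>k = theta5 t k\<close>. As \<open>Y U\<close> is
positive, it is the first one. Cancelling against \<open>X Y\<close> and \<open>U V\<close> then gives linear
relations between \<open>X\<close> and \<open>U\<close> and between \<open>Y\<close> and \<open>V\<close>, which turn the expressions of
\<open>E\<^sub>1\<^sup>2\<close> and \<open>E\<^sub>2\<^sup>2\<close> by theta series at \<open>t^5\<close> into those at \<open>t\<close>.
\<close>

theorem pentagonal_square_representations:
  fixes s :: real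
  assumes s: "0 < s" "s < 1"
  defines "t \<equiv> s\<^sup>2"
  shows "theta 1 t * theta5 t 1 - t * (theta t t * theta5 t 4) = (theta (- s) (s ^ 5))\<^sup>2"
    and "theta t t * theta5 t 2 - theta 1 t * theta5 t 3 = (theta (- (s ^ 3)) (s ^ 5))\<^sup>2"
    and "theta t t * theta5 t 0 - t * (theta 1 t * theta5 t 5) = 2 * (theta (- s) (s ^ 5) * theta (- (s ^ 3)) (s ^ 5))"
proof -
  have t: "0 < t" "t < 1" using s by (auto simp: t_def power_less_one_iff)
  define \<Phi> where "\<Phi> = theta 1 t"
  define \<Psi> where "\<Psi> = theta t t"
  define X where "X = \<Phi> - theta5 t 0"
  define Y where "Y = \<Phi> + theta5 t 0"
  define U where "U = \<Psi> - t * theta5 t 5"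
  define V where "V = \<Psi> + t * theta5 t 5"
  note sq = pentagonal_squares[OF s, folded t_def]
  have pos: "0 < \<Phi>" "0 < \<Psi>" "0 < theta5 t k" for k
    unfolding \<Phi>_def \<Psi>_def using t by (auto intro: theta_pos theta5_pos)
  have Y: "0 < Y" and V: "0 < V" unfolding Y_def V_def using pos t by (auto intro!: add_pos_pos mult_pos_pos)
  have XY: "X * Y = 4 * t * theta5 t 2 * theta5 t 4"
    using phi_square_identity[OF t] unfolding X_def Y_def \<Phi>_def by (simp add: algebra_simps power2_eq_square)
  have UV: "U * V = 4 * theta5 t 1 * theta5 t 3"
    using psi_square_identity[OF t] unfolding U_def V_def \<Psi>_def by (simp add: algebra_simps power2_eq_square)
  have U: "0 < U"
    using UV V pos by (metis mult_pos_pos zero_less_mult_pos2 zero_less_numeral)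
  have e: "\<Psi> * theta5 t 0 - t * (\<Phi> * theta5 t 5) = 2 * (theta5 t 1 * theta5 t 2 - t * theta5 t 3 * theta5 t 4)"
    using theta_euler_product[OF s, folded t_def] unfolding euler_factor_5[OF s, symmetric] sq(3) \<Phi>_def \<Psi>_def
    by (simp add: theta5_def)
  have sum: "Y * U - X * V = 4 * (theta5 t 1 * theta5 t 2 - t * theta5 t 3 * theta5 t 4)"
    using e unfolding X_def Y_def U_def V_def by (simp add: algebra_simps)
  have prod: "(Y * U) * (X * V) = (4 * (theta5 t 1 * theta5 t 2)) * (4 * (t * theta5 t 3 * theta5 t 4))"
  proof -
    have "(Y * U) * (X * V) = (X * Y) * (U * V)" by simp
    then show ?thesis unfolding XY UV by simp
  qed
  have "(Y * U - 4 * (theta5 t 1 * theta5 t 2)) * (Y * U + 4 * (t * theta5 t 3 * theta5 t 4)) = 0"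
  proof -
    have "X * V = Y * U - 4 * (theta5 t 1 * theta5 t 2) + 4 * (t * theta5 t 3 * theta5 t 4)"
      using sum by (simp add: algebra_simps)
    with prod have "(Y * U) * (Y * U - 4 * (theta5 t 1 * theta5 t 2) + 4 * (t * theta5 t 3 * theta5 t 4)) =
        (4 * (theta5 t 1 * theta5 t 2)) * (4 * (t * theta5 t 3 * theta5 t 4))" by simp
    then show ?thesis by (simp add: algebra_simps)
  qed
  moreover have "0 < Y * U + 4 * (t * theta5 t 3 * theta5 t 4)"
    using Y U t pos by (intro add_pos_pos mult_pos_pos) auto
  ultimately have YU: "Y * U = 4 * (theta5 t 1 * theta5 t 2)" by simp
  have "theta5 t 1 * X = t * theta5 t 4 * U"
  proof -
    have "4 * theta5 t 2 * (theta5 t 1 * X) = X * (Y * U)" unfolding YU by simp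
    also have "\<dots> = 4 * theta5 t 2 * (t * theta5 t 4 * U)" using XY by simp
    finally show ?thesis using pos(3)[of 2] by simp
  qed
  then show "theta 1 t * theta5 t 1 - t * (theta t t * theta5 t 4) = (theta (- s) (s ^ 5))\<^sup>2"
    unfolding sq(1) X_def U_def \<Phi>_def[symmetric] \<Psi>_def[symmetric]
    by (simp add: algebra_simps power2_eq_square)
  have "theta5 t 2 * V = Y * theta5 t 3"
  proof -
    have "U * (theta5 t 2 * V) = (U * V) * theta5 t 2" by simp
    also have "\<dots> = (Y * U) * theta5 t 3" unfolding UV YU by simp
    finally show ?thesis using U by simp
  qed
  then show "theta t t * theta5 t 2 - theta 1 t * theta5 t 3 = (theta (- (s ^ 3)) (s ^ 5))\<^sup>2"
    unfolding sq(2) Y_def V_def \<Phi>_def[symmetric] \<Psi>_def[symmetric]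
    by (simp add: algebra_simps power2_eq_square)
  show "theta t t * theta5 t 0 - t * (theta 1 t * theta5 t 5) = 2 * (theta (- s) (s ^ 5) * theta (- (s ^ 3)) (s ^ 5))"
    unfolding sq(3) using e by (simp add: \<Phi>_def \<Psi>_def)
qed

section \<open>The 5-dissections\<close>

text \<open>
The congruences on \<open>a\<close> and \<open>b\<close> modulo 5 make every theta series on the right a function
of \<open>t = q^5\<close>, so that the sum over \<open>r\<close> is the 5-dissection. Since \<open>theta (1/z) = theta z\<close>, the
sign of \<open>a\<close> can be chosen to satisfy them.
\<close>

lemma theta_quintisect:
  fixes q :: real
  assumes q: "0 < q" "q < 1" and ab: "a + 2 * b = 5 * c" "b - 2 * a = 5 * d"
  defines "t \<equiv> q ^ 5"
  shows "theta (q powi a) t * theta (- (q powi b)) t =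
    (\<Sum>r\<in>{-2..2::int}. q powi (a * r + 5 * r\<^sup>2) * (theta5 t (c + 2 * r) * theta5_neg t (d - 4 * r)))"
proof -
  have t: "0 < t" "t < 1" using q by (auto simp: t_def power_less_one_iff)
  have tp: "t powi k = q powi (5 * k)" for k by (simp add: t_def power_int_power)
  have e0: "(q powi a) powi r * t powi r\<^sup>2 = q powi (a * r + 5 * r\<^sup>2)" for r
    using q by (simp add: tp power_int_add power_int_mult)
  have e1: "q powi a * (- (q powi b))\<^sup>2 * t powi (2 * r) = t powi (c + 2 * r)" for r
  proof -
    have "q powi a * (- (q powi b))\<^sup>2 * t powi (2 * r) = q powi a * (q powi b * q powi b) * q powi (5 * (2 * r))"
      by (simp only: tp power2_eq_square minus_mult_minus)
    also have "\<dots> = q powi (a + (b + b) + 5 * (2 * r))"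
      using q by (simp only: power_int_add[OF disjI1] less_imp_neq[symmetric] not_False_eq_True)
    also have "\<dots> = q powi (a + 2 * b + 10 * r)"
      by (rule arg_cong[of _ _ "\<lambda>k. q powi k"]) simp
    also have "\<dots> = t powi (c + 2 * r)"
      unfolding tp ab(1) by (simp add: algebra_simps)
    finally show ?thesis .
  qed
  have e2: "- (q powi b) * (q powi a) powi (-2) * t powi (-4 * r) = - (t powi (d - 4 * r))" for r
  proof -
    have "q powi b * (q powi a) powi (-2) * t powi (-4 * r) = q powi (b + a * (-2) + 5 * (-4 * r))"
      using q by (simp only: tp power_int_mult[symmetric] power_int_add[OF disjI1] less_imp_neq[symmetric]
          not_False_eq_True)
    also have "b + a * (-2) + 5 * (-4 * r) = 5 * (d - 4 * r)"
      using ab(2) by (simp add: algebra_simps)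
    finally show ?thesis unfolding tp by simp
  qed
  show ?thesis
    using theta_product_5[OF t, of "q powi a" "- (q powi b)"] q unfolding e0 e1 e2
    by (simp add: theta5_def theta5_neg_def)
qed

text \<open>
Reducing the indices of \<open>theta_quintisect\<close> to \<open>0, ..., 5\<close> contributes powers of \<open>t\<close>, and terms
with \<open>theta5_neg t 5 = 0\<close> drop out; this is why only four classes modulo 5 occur.
\<close>

lemma theta_dissections:
  fixes r :: real
  assumes r: "0 < r" "r < 1"
  defines "q \<equiv> r\<^sup>2" and "t \<equiv> r ^ 10"
  shows "(theta (r ^ 3) (r ^ 5))\<^sup>2 * theta (- q) t =
      theta5_neg t 1 * (theta 1 t * theta5 t 1 - t * (theta t t * theta5 t 4)) +
      q * theta5_neg t 1 * (theta t t * theta5 t 0 - t * (theta 1 t * theta5 t 5)) +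
      q ^ 2 * theta5_neg t 3 * (theta 1 t * theta5 t 1 - t * (theta t t * theta5 t 4)) +
      q ^ 4 * theta5_neg t 3 * (theta t t * theta5 t 2 - theta 1 t * theta5 t 3)" (is ?G)
    and "(theta r (r ^ 5))\<^sup>2 * theta (- (q ^ 3)) t =
      theta5_neg t 1 * (theta 1 t * theta5 t 1 - t * (theta t t * theta5 t 4)) +
      q ^ 2 * theta5_neg t 1 * (theta t t * theta5 t 2 - theta 1 t * theta5 t 3) +
      q ^ 3 * theta5_neg t 3 * (theta t t * theta5 t 0 - t * (theta 1 t * theta5 t 5)) -
      q ^ 4 * theta5_neg t 3 * (theta t t * theta5 t 2 - theta 1 t * theta5 t 3)" (is ?H)
proof -
  have q: "0 < q" "q < 1" using r by (auto simp: q_def power_less_one_iff)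
  have tq: "t = q ^ 5" by (simp add: t_def q_def power_mult[symmetric])
  have t: "0 < t" using r by (simp add: t_def)
  have r5: "0 < r ^ 5" "r ^ 5 < 1" using r by (auto simp: power_less_one_iff)
  have r5t: "(r ^ 5)\<^sup>2 = t" by (simp add: t_def power_mult[symmetric])
  note red = theta5_reduce[OF t] theta5_neg_reduce[OF t]
  have A: "theta (q ^ 3 * t) t = theta (q powi (-2)) t / q ^ 3"
  proof -
    have "q powi (-2) = 1 / q ^ 2" by (simp add: power_int_minus_divide)
    then have "q powi (-2) * t\<^sup>2 = q ^ 3 * t" "q powi (-2) * t = q ^ 3"
      using q by (simp_all add: tq power_mult[symmetric] power_add[symmetric] divide_eq_eq)
    then show ?thesis
      using theta_shift[of t "q powi (-2)"] t q by simp
  qed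
  have B: "theta (q * t) t = theta (q powi 4) t / q"
  proof -
    have "q powi (-4) = 1 / q ^ 4" by (simp add: power_int_minus_divide)
    then have "q powi (-4) * t\<^sup>2 = q * t" "q powi (-4) * t = q"
      using q by (simp_all add: tq power_mult[symmetric] power_add[symmetric] divide_eq_eq flip: power_Suc)
    then have "theta (q * t) t = theta (q powi (-4)) t / q"
      using theta_shift[of t "q powi (-4)"] t q by simp
    then show ?thesis using theta_inverse[of "q powi 4" t] q by (simp add: power_int_minus)
  qed
  have "(theta (r ^ 3) (r ^ 5))\<^sup>2 = theta 1 t * theta (q powi 3) t + q * (theta t t * theta (q powi (-2)) t)"
  proof -
    have "(r ^ 3)\<^sup>2 = q ^ 3" "r ^ 3 * r ^ 5 = q * q ^ 3" by (simp_all add: q_def power_mult[symmetric] power_add[symmetric] flip: power_Suc)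
    then show ?thesis
      using theta_square_split[OF r5, of "r ^ 3"] r q unfolding r5t by (simp add: A)
  qed
  then have "(theta (r ^ 3) (r ^ 5))\<^sup>2 * theta (- q) t =
      theta 1 t * (theta (q powi 3) t * theta (- (q powi 1)) t) + q * (theta t t * (theta (q powi (-2)) t * theta (- (q powi 1)) t))"
    by (simp add: algebra_simps)
  also have "theta (q powi 3) t * theta (- (q powi 1)) t =
      (\<Sum>r\<in>{-2..2::int}. q powi (3 * r + 5 * r\<^sup>2) * (theta5 t (1 + 2 * r) * theta5_neg t (-1 - 4 * r)))"
    unfolding tq by (rule theta_quintisect[OF q]) auto
  also have "\<dots> = theta5 t 1 * theta5_neg t 1 + q ^ 2 * theta5 t 1 * theta5_neg t 3 - q * t * theta5 t 5 * theta5_neg t 1 - q ^ 4 * theta5 t 3 * theta5_neg t 3"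
    using q unfolding sum_minus2_2 by (simp add: red) (simp add: tq field_simps eval_nat_numeral)
  also have "theta (q powi (-2)) t * theta (- (q powi 1)) t =
      (\<Sum>r\<in>{-2..2::int}. q powi (-2 * r + 5 * r\<^sup>2) * (theta5 t (0 + 2 * r) * theta5_neg t (1 - 4 * r)))"
    unfolding tq by (rule theta_quintisect[OF q]) auto
  also have "\<dots> = theta5 t 0 * theta5_neg t 1 + q ^ 3 * theta5 t 2 * theta5_neg t 3 - q * t * theta5 t 4 * theta5_neg t 3 - q ^ 4 * theta5 t 4 * theta5_neg t 1"
    using q unfolding sum_minus2_2 by (simp add: red) (simp add: tq field_simps eval_nat_numeral)
  finally show ?G by (simp add: tq algebra_simps eval_nat_numeral)
  have "(theta r (r ^ 5))\<^sup>2 = theta 1 t * theta (q powi 1) t + q ^ 2 * (theta t t * theta (q powi 4) t)"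
  proof -
    have "r\<^sup>2 = q" "r * r ^ 5 = q * q ^ 2" by (simp_all add: q_def power_mult[symmetric] power_add[symmetric] flip: power_Suc)
    then show ?thesis
      using theta_square_split[OF r5, of "r"] r q unfolding r5t by (simp add: B power2_eq_square)
  qed
  also have "theta (q powi 1) t = theta (q powi (-1)) t"
    using theta_inverse[of q t] q by (simp add: power_int_minus)
  finally have "(theta r (r ^ 5))\<^sup>2 * theta (- (q ^ 3)) t =
      theta 1 t * (theta (q powi (-1)) t * theta (- (q powi 3)) t) + q ^ 2 * (theta t t * (theta (q powi 4) t * theta (- (q powi 3)) t))"
    by (simp add: algebra_simps)
  also have "theta (q powi (-1)) t * theta (- (q powi 3)) t =
      (\<Sum>r\<in>{-2..2::int}. q powi (-1 * r + 5 * r\<^sup>2) * (theta5 t (1 + 2 * r) * theta5_neg t (1 - 4 * r)))"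
    unfolding tq by (rule theta_quintisect[OF q]) auto
  also have "\<dots> = theta5 t 1 * theta5_neg t 1 + q ^ 4 * theta5 t 3 * theta5_neg t 3 - q ^ 3 * t * theta5 t 5 * theta5_neg t 3 - q ^ 2 * theta5 t 3 * theta5_neg t 1"
    using q unfolding sum_minus2_2 by (simp add: red) (simp add: tq field_simps eval_nat_numeral)
  also have "theta (q powi 4) t * theta (- (q powi 3)) t =
      (\<Sum>r\<in>{-2..2::int}. q powi (4 * r + 5 * r\<^sup>2) * (theta5 t (2 + 2 * r) * theta5_neg t (-1 - 4 * r)))"
    unfolding tq by (rule theta_quintisect[OF q]) auto
  also have "\<dots> = theta5 t 2 * theta5_neg t 1 + q * theta5 t 0 * theta5_neg t 3 - q ^ 3 * theta5 t 4 * theta5_neg t 1 - q ^ 2 * theta5 t 2 * theta5_neg t 3"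
    using q unfolding sum_minus2_2 by (simp add: red) (simp add: tq field_simps eval_nat_numeral)
  finally show ?H by (simp add: tq algebra_simps eval_nat_numeral)
qed

lemma qpochhammer_inf_of_real:
  fixes q :: real
  assumes "\<bar>q\<bar> < 1"
  shows "qpochhammer_inf (map of_real as) (of_real q) = of_real (\<Prod>a\<leftarrow>as. \<Prod>n. 1 - a * q ^ n)"
proof -
  have "(\<Prod>n. 1 - of_real a * of_real q ^ n) = (of_real (\<Prod>n. 1 - a * q ^ n) :: complex)" for a
  proof -
    have "(\<lambda>n. 1 - a * q ^ n) has_prod (\<Prod>n. 1 - a * q ^ n)"
      using convergent_prod_one_plus_geometric[OF assms, of "- a"] by (simp add: convergent_prod_has_prod)
    then have "(\<lambda>n. of_real (1 - a * q ^ n) :: complex) has_prod of_real (\<Prod>n. 1 - a * q ^ n)"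
      by (simp only: has_prod_of_real_iff)
    then show ?thesis by (simp add: has_prod_unique[symmetric])
  qed
  then show ?thesis
    unfolding qpochhammer_inf_def by (induction as) auto
qed

lemma euler_product_two_plus:
  assumes t: "0 < t" "t < 1"
  shows "euler_product (\<lambda>k. 2 + on_class 2 2 k) t = (euler_product (on_class 1 1) t)\<^sup>2 * euler_product (on_class 2 2) t"
proof -
  have "(\<lambda>k. 2 + on_class 2 2 k) = (\<lambda>k. on_class 1 1 k + on_class 1 1 k + on_class 2 2 k)"
    by (simp add: on_class_def fun_eq_iff)
  then show ?thesis
    using euler_product_add3[OF t, of "on_class 1 1" "Suc 0" "on_class 1 1" "on_class 2 2"] by (simp add: power2_eq_square)
qed

text \<open>
The denominator \<open>(t)\<^sub>1\<^sup>2 (t)\<^sub>2\<close> consists of the third factors of the three triple products.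
\<close>

lemma generating_functions:
  fixes r :: real
  assumes r: "0 < r" "r < 1"
  defines "q \<equiv> r\<^sup>2" and "t \<equiv> r ^ 10"
  shows "(qpochhammer_inf [- of_real q, - (of_real q ^ 4)] (of_real q ^ 5))\<^sup>2 * qpochhammer_inf [of_real q ^ 4, of_real q ^ 6] (of_real q ^ 10)
      = of_real ((theta (r ^ 3) (r ^ 5))\<^sup>2 * theta (- q) t / euler_product (\<lambda>k. 2 + on_class 2 2 k) t)" (is ?G)
    and "(qpochhammer_inf [- (of_real q ^ 2), - (of_real q ^ 3)] (of_real q ^ 5))\<^sup>2 * qpochhammer_inf [of_real q ^ 2, of_real q ^ 8] (of_real q ^ 10)
      = of_real ((theta r (r ^ 5))\<^sup>2 * theta (- (q ^ 3)) t / euler_product (\<lambda>k. 2 + on_class 2 2 k) t)" (is ?H)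
proof -
  have q: "0 < q" "q < 1" using r by (auto simp: q_def power_less_one_iff)
  have q5: "\<bar>q ^ 5\<bar> < 1" "\<bar>q ^ 10\<bar> < 1" using q by (auto simp: power_less_one_iff)
  have t: "0 < t" "t < 1" using r by (auto simp: t_def power_less_one_iff)
  have tq: "t = q ^ 5" by (simp add: t_def q_def power_mult[symmetric])
  define P where "P = (\<lambda>a. \<Prod>n. 1 + q ^ (5 * n + a))"
  define N where "N = (\<lambda>a. \<Prod>n. 1 - q ^ (10 * n + a))"
  define J where "J = (\<Prod>n. 1 - q ^ (5 * n + 5))"
  have Pq: "(\<Prod>n. 1 - - (q ^ a) * (q ^ 5) ^ n) = P a" for a
    unfolding P_def by (simp only: power_add power_mult) (simp add: mult.commute)
  have Nq: "(\<Prod>n. 1 - q ^ a * (q ^ 10) ^ n) = N a" for a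
    unfolding N_def by (simp only: power_add power_mult) (simp add: mult.commute)
  have J: "J = euler_product (on_class 1 1) t"
  proof -
    have "euler_product (on_class 1 1) t = (\<Prod>n. 1 - t ^ (1 * n + 1))"
      by (rule prodinf_on_class[OF t, symmetric]) auto
    also have "(\<lambda>n. 1 - t ^ (1 * n + 1)) = (\<lambda>n. 1 - q ^ (5 * n + 5))"
      by (simp add: tq power_mult[symmetric] fun_eq_iff algebra_simps flip: power_Suc power_add)
    finally show ?thesis by (simp only: J_def)
  qed
  have N10: "N 10 = euler_product (on_class 2 2) t"
  proof -
    have "euler_product (on_class 2 2) t = (\<Prod>n. 1 - t ^ (2 * n + 2))"
      by (rule prodinf_on_class[OF t, symmetric]) auto
    also have "(\<lambda>n. 1 - t ^ (2 * n + 2)) = (\<lambda>n. 1 - q ^ (10 * n + 10))"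
      unfolding tq power_mult[symmetric] by (simp add: add.commute)
    finally show ?thesis by (simp only: N_def)
  qed
  have pos: "0 < J" "0 < N 10"
    unfolding J N10 by (auto intro!: euler_product_pos[OF t, of _ "Suc 0"])
  have den: "euler_product (\<lambda>k. 2 + on_class 2 2 k) t = J\<^sup>2 * N 10"
    unfolding euler_product_two_plus[OF t] J N10 ..
  have G1: "theta (r ^ 3) (r ^ 5) = P 4 * P 1 * J"
    using theta_prodinf[OF r, of "r ^ 3" 1 4 1] unfolding P_def J_def q_def by (simp add: eval_nat_numeral)
  have G2: "theta (- q) t = N 6 * N 4 * N 10"
    using theta_prodinf[OF r, of "r ^ 2" 4 6 "-1"] unfolding N_def q_def t_def by (simp add: power_add[symmetric])
  have H1: "theta r (r ^ 5) = P 3 * P 2 * J"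
    using theta_prodinf[OF r, of "r" 2 3 1] unfolding P_def J_def q_def by (simp add: eval_nat_numeral)
  have H2: "theta (- (q ^ 3)) t = N 8 * N 2 * N 10"
    using theta_prodinf[OF r, of "r ^ 6" 2 8 "-1"] unfolding N_def q_def t_def by (simp add: power_add[symmetric] power_mult[symmetric])
  show ?G
    using qpochhammer_inf_of_real[OF q5(1), of "[- q, - (q ^ 4)]"] qpochhammer_inf_of_real[OF q5(2), of "[q ^ 4, q ^ 6]"]
      Pq[of 1] Pq[of 4] Nq[of 4] Nq[of 6] pos
    unfolding G1 G2 den by (simp add: power_mult_distrib)
  show ?H
    using qpochhammer_inf_of_real[OF q5(1), of "[- (q ^ 2), - (q ^ 3)]"] qpochhammer_inf_of_real[OF q5(2), of "[q ^ 2, q ^ 8]"]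
      Pq[of 2] Pq[of 3] Nq[of 2] Nq[of 8] pos
    unfolding H1 H2 den by (simp add: power_mult_distrib)
qed

section \<open>Partition products modulo 10\<close>

lemma cong_pm_10:
  assumes "k mod 10 = j"
  shows "k \<in> cong_pm 10 R \<longleftrightarrow> (\<exists>r\<in>R. int j = r mod 10 \<or> int j = (- r) mod 10)"
  using assms by (auto simp: cong_pm_def cong_def zmod_int)

lemma residues_mod_10:
  fixes k :: nat
  shows "\<exists>j\<in>{0,1,2,3,4,5,6,7,8,9}. k mod 10 = j \<and> k mod 5 = j mod 5 \<and> k mod 2 = j mod 2"
proof -
  have "j \<in> {0,1,2,3,4,5,6,7,8,9}" if "j < 10" for j :: nat
    using that
    by (simp add: lessThan_iff[symmetric] lessThan_nat_numeral lessThan_Suc del: lessThan_iff) (elim disjE, simp_all)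
  from this[of "k mod 10"] show ?thesis
    by (intro bexI[of _ "k mod 10"]) (simp_all add: mod_mod_cancel)
qed

text \<open>
The denominator is \<open>(t)\<^sub>1\<^sup>2 (t)\<^sub>2\<close>; see \<open>euler_product_two_plus\<close>.
\<close>

definition quotient3 :: "(nat \<Rightarrow> nat) \<Rightarrow> (nat \<Rightarrow> nat) \<Rightarrow> (nat \<Rightarrow> nat) \<Rightarrow> real \<Rightarrow> real" where
  "quotient3 u v w t = euler_product u t * euler_product v t * euler_product w t / euler_product (\<lambda>k. 2 + on_class 2 2 k) t"

lemma quotient3_sums:
  fixes S :: "nat set"
  assumes "\<And>k. (if k \<in> S then flav k else 0) + (u k + v k + w k) = 2 + on_class 2 2 k"
    and t: "0 < t" "t < 1"
  shows "(\<lambda>n. real (num_partitions S flav n) * t ^ n) sums quotient3 u v w t"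
proof -
  have le: "2 + on_class 2 2 k \<le> 3" for k
    using on_class_le[of 2 2 k] by linarith
  have "u k \<le> 3" "v k \<le> 3" "w k \<le> 3" for k
    using assms(1)[of k] le[of k] by linarith+
  then have "euler_product (\<lambda>k. u k + v k + w k) t = euler_product u t * euler_product v t * euler_product w t"
    by (intro euler_product_add3[OF t])
  then show ?thesis
    using sums_quotient_flavoured[OF t assms(1) le] unfolding quotient3_def by simp
qed

text \<open>
The denominator \<open>(t)\<^sub>1\<^sup>2 (t)\<^sub>2\<close> has exponent \<open>2 + on_class 2 2 k\<close>. A factor \<open>1 - t^k\<close> that survives the
cancellation of a component against it is a flavour of the part \<open>k\<close>.
\<close>

lemma exponent_identities:
  shows "(if k \<in> cong_pm 10 {1, 2, 4} then if k \<in> cong_pm 10 {1, 4} then 2 else 1 else 0) +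
      (triple_class 10 4 k + triple_class 5 2 k + triple_class 5 2 k) = 2 + on_class 2 2 k"
    and "(if k \<in> cong_pm 10 {1, 2, 3, 4} then if k \<in> cong_pm 10 {2} then 2 else 1 else 0) +
      (triple_class 10 4 k + triple_class 5 2 k + triple_class 5 1 k) = 2 + on_class 2 2 k"
    and "(if k \<in> cong_pm 10 {1, 4} then if k \<in> cong_pm 10 {1} then 2 else 3 else 0) +
      (triple_class 10 2 k + triple_class 5 2 k + triple_class 5 2 k) = 2 + on_class 2 2 k"
    and "(if k \<in> cong_pm 10 {2, 3, 4} then if k \<in> cong_pm 10 {2, 3} then 2 else 1 else 0) +
      (triple_class 10 2 k + triple_class 5 1 k + triple_class 5 1 k) = 2 + on_class 2 2 k"
    and "(if k \<in> cong_pm 10 {2, 3} then if k \<in> cong_pm 10 {3} then 2 else 3 else 0) +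
      (triple_class 10 4 k + triple_class 5 1 k + triple_class 5 1 k) = 2 + on_class 2 2 k"
    and "(if k \<in> cong_pm 10 {1, 2, 3, 4} then if k \<in> cong_pm 10 {4} then 2 else 1 else 0) +
      (triple_class 10 2 k + triple_class 5 2 k + triple_class 5 1 k) = 2 + on_class 2 2 k"
proof -
  obtain j where j: "j \<in> {0,1,2,3,4,5,6,7,8,9}" and k: "k mod 10 = j" "k mod 5 = j mod 5" "k mod 2 = j mod 2"
    using residues_mod_10[of k] by (elim bexE conjE) (rule that)
  note defs = triple_class_def on_class_def cong_pm_10[OF k(1)] k
  from j show "(if k \<in> cong_pm 10 {1, 2, 4} then if k \<in> cong_pm 10 {1, 4} then 2 else 1 else 0) +
      (triple_class 10 4 k + triple_class 5 2 k + triple_class 5 2 k) = 2 + on_class 2 2 k"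
      "(if k \<in> cong_pm 10 {1, 2, 3, 4} then if k \<in> cong_pm 10 {2} then 2 else 1 else 0) +
      (triple_class 10 4 k + triple_class 5 2 k + triple_class 5 1 k) = 2 + on_class 2 2 k"
      "(if k \<in> cong_pm 10 {1, 4} then if k \<in> cong_pm 10 {1} then 2 else 3 else 0) +
      (triple_class 10 2 k + triple_class 5 2 k + triple_class 5 2 k) = 2 + on_class 2 2 k"
      "(if k \<in> cong_pm 10 {2, 3, 4} then if k \<in> cong_pm 10 {2, 3} then 2 else 1 else 0) +
      (triple_class 10 2 k + triple_class 5 1 k + triple_class 5 1 k) = 2 + on_class 2 2 k"
      "(if k \<in> cong_pm 10 {2, 3} then if k \<in> cong_pm 10 {3} then 2 else 3 else 0) +
      (triple_class 10 4 k + triple_class 5 1 k + triple_class 5 1 k) = 2 + on_class 2 2 k"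
      "(if k \<in> cong_pm 10 {1, 2, 3, 4} then if k \<in> cong_pm 10 {4} then 2 else 1 else 0) +
      (triple_class 10 2 k + triple_class 5 2 k + triple_class 5 1 k) = 2 + on_class 2 2 k"
    unfolding defs by (elim insertE emptyE; simp)+
qed

lemma partition_sums:
  fixes t :: real
  assumes t: "0 < t" "t < 1"
  shows "(\<lambda>n. real (num_partitions (cong_pm 10 {1, 2, 4})
      (\<lambda>k. if k \<in> cong_pm 10 {1, 4} then 2 else 1) n) * t ^ n) sums quotient3 (triple_class 10 4) (triple_class 5 2) (triple_class 5 2) t"
    and "(\<lambda>n. real (num_partitions (cong_pm 10 {1, 2, 3, 4})
      (\<lambda>k. if k \<in> cong_pm 10 {2} then 2 else 1) n) * t ^ n) sums quotient3 (triple_class 10 4) (triple_class 5 2) (triple_class 5 1) t"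
    and "(\<lambda>n. real (num_partitions (cong_pm 10 {1, 4})
      (\<lambda>k. if k \<in> cong_pm 10 {1} then 2 else 3) n) * t ^ n) sums quotient3 (triple_class 10 2) (triple_class 5 2) (triple_class 5 2) t"
    and "(\<lambda>n. real (num_partitions (cong_pm 10 {2, 3, 4})
      (\<lambda>k. if k \<in> cong_pm 10 {2, 3} then 2 else 1) n) * t ^ n) sums quotient3 (triple_class 10 2) (triple_class 5 1) (triple_class 5 1) t"
    and "(\<lambda>n. real (num_partitions (cong_pm 10 {2, 3})
      (\<lambda>k. if k \<in> cong_pm 10 {3} then 2 else 3) n) * t ^ n) sums quotient3 (triple_class 10 4) (triple_class 5 1) (triple_class 5 1) t"
    and "(\<lambda>n. real (num_partitions (cong_pm 10 {1, 2, 3, 4})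
      (\<lambda>k. if k \<in> cong_pm 10 {4} then 2 else 1) n) * t ^ n) sums quotient3 (triple_class 10 2) (triple_class 5 2) (triple_class 5 1) t"
  by (rule quotient3_sums[OF exponent_identities(1) t],
      rule quotient3_sums[OF exponent_identities(2) t],
      rule quotient3_sums[OF exponent_identities(3) t],
      rule quotient3_sums[OF exponent_identities(4) t],
      rule quotient3_sums[OF exponent_identities(5) t],
      rule quotient3_sums[OF exponent_identities(6) t])

lemma theta_quotients:
  fixes r :: real
  assumes r: "0 < r" "r < 1"
  defines "q \<equiv> r\<^sup>2" and "t \<equiv> r ^ 10" and "D \<equiv> euler_product (\<lambda>k. 2 + on_class 2 2 k) (r ^ 10)"
  shows "(theta (r ^ 3) (r ^ 5))\<^sup>2 * theta (- q) t / D =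
      quotient3 (triple_class 10 4) (triple_class 5 2) (triple_class 5 2) t
      + q * (2 * quotient3 (triple_class 10 4) (triple_class 5 2) (triple_class 5 1) t)
     
          + q ^ 2 * quotient3 (triple_class 10 2) (triple_class 5 2) (triple_class 5 2) t
          + q ^ 4 * quotient3 (triple_class 10 2) (triple_class 5 1) (triple_class 5 1) t"
    and "(theta r (r ^ 5))\<^sup>2 * theta (- (q ^ 3)) t / D =
        quotient3 (triple_class 10 4) (triple_class 5 2) (triple_class 5 2) t
        + q ^ 2 * quotient3 (triple_class 10 4) (triple_class 5 1) (triple_class 5 1) t
     
          + q ^ 3 * (2 * quotient3 (triple_class 10 2) (triple_class 5 2) (triple_class 5 1) t)
          + q ^ 4 * (- quotient3 (triple_class 10 2) (triple_class 5 1) (triple_class 5 1) t)"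
proof -
  \<comment> \<open>\<open>t = s\<^sup>2\<close>: the square root needed by the triple products in \<open>t\<close>\<close>
  define s where "s = r ^ 5"
  have s: "0 < s" "s < 1" using r by (auto simp: s_def power_less_one_iff)
  have ts: "t = s\<^sup>2" by (simp add: t_def s_def power_mult[symmetric])
  have E1: "theta (- s) (s ^ 5) = euler_product (triple_class 5 2) t" unfolding ts
    by (rule theta_minus_euler_product[OF s, of _ _ 3]) (simp_all add: eval_nat_numeral)
  have E2: "theta (- (s ^ 3)) (s ^ 5) = euler_product (triple_class 5 1) t" unfolding ts
    by (rule theta_minus_euler_product[OF s, of _ _ 4]) (simp_all add: eval_nat_numeral)
  have t5: "t ^ 5 = s ^ 10" by (simp add: ts power_mult[symmetric])
  have O1: "theta5_neg t 1 = euler_product (triple_class 10 4) t"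
    unfolding theta5_neg_def t5 unfolding ts
    by (rule theta_minus_euler_product[OF s, of _ _ 6]) (simp_all add: eval_nat_numeral)
  have O3: "theta5_neg t 3 = euler_product (triple_class 10 2) t"
    unfolding theta5_neg_def t5 unfolding ts
    by (rule theta_minus_euler_product[OF s, of _ _ 8]) (simp_all add: eval_nat_numeral)
  note id = pentagonal_square_representations[OF s, folded ts, unfolded E1 E2]
  show "(theta (r ^ 3) (r ^ 5))\<^sup>2 * theta (- q) t / D =
      quotient3 (triple_class 10 4) (triple_class 5 2) (triple_class 5 2) t
      + q * (2 * quotient3 (triple_class 10 4) (triple_class 5 2) (triple_class 5 1) t)
     
          + q ^ 2 * quotient3 (triple_class 10 2) (triple_class 5 2) (triple_class 5 2) t
          + q ^ 4 * quotient3 (triple_class 10 2) (triple_class 5 1) (triple_class 5 1) t"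
    unfolding theta_dissections(1)[OF r, folded q_def t_def] id O1 O3 quotient3_def D_def t_def[symmetric]
    by (simp add: power2_eq_square add_divide_distrib mult_ac)
  show "(theta r (r ^ 5))\<^sup>2 * theta (- (q ^ 3)) t / D =
      quotient3 (triple_class 10 4) (triple_class 5 2) (triple_class 5 2) t
      + q ^ 2 * quotient3 (triple_class 10 4) (triple_class 5 1) (triple_class 5 1) t
     
          + q ^ 3 * (2 * quotient3 (triple_class 10 2) (triple_class 5 2) (triple_class 5 1) t)
          + q ^ 4 * (- quotient3 (triple_class 10 2) (triple_class 5 1) (triple_class 5 1) t)"
    unfolding theta_dissections(2)[OF r, folded q_def t_def] id O1 O3 quotient3_def D_def t_def[symmetric]
    by (simp add: power2_eq_square add_divide_distrib diff_divide_distrib mult_ac)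
qed

section \<open>Comparing coefficients\<close>

text \<open>
Divided by its lowest power of \<open>x\<close>, the series has a nonzero limit at 0, but it vanishes at the
points \<open>1/(n + 2)\<close>.
\<close>

lemma powser_coeffs_zero_of_real_zeros:
  fixes d :: "nat \<Rightarrow> complex"
  assumes zero: "\<And>x. 0 < x \<Longrightarrow> x < 1 \<Longrightarrow> (\<lambda>n. d n * of_real x ^ n) sums 0"
  shows "d n = 0"
proof (rule ccontr)
  assume "d n \<noteq> 0"
  define m where "m = (LEAST k. d k \<noteq> 0)"
  have m: "d m \<noteq> 0" unfolding m_def by (rule LeastI[of _ n]) fact
  have less: "d k = 0" if "k < m" for k
    using not_less_Least[of k "\<lambda>k. d k \<noteq> 0"] that unfolding m_def by blast
  define b where "b = (\<lambda>k. d (k + m))"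
  have b0: "(\<lambda>k. b k * of_real x ^ k) sums 0" if x: "0 < x" "x < 1" for x
  proof -
    have "(\<lambda>k. d (k + m) * of_real x ^ (k + m)) sums 0"
      using sums_zero_iff_shift[of m "\<lambda>n. d n * of_real x ^ n" 0] zero[OF x] less by simp
    then have "(\<lambda>k. of_real x ^ m * (b k * of_real x ^ k)) sums (of_real x ^ m * 0)"
      by (simp add: b_def power_add mult_ac)
    then show ?thesis
      using x by (subst (asm) sums_mult_iff) auto
  qed
  have summ: "summable (\<lambda>k. b k * z ^ k)" if "norm z < 1/2" for z
    using powser_inside[of b "of_real (1/2)" z] sums_summable[OF b0[of "1/2"]] that by simp
  have "((\<lambda>z. \<Sum>k. b k * z ^ k) \<longlongrightarrow> b 0) (at 0)"
    by (rule powser_limit_0[of "1/2"]) (use summ summable_sums in auto)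
  moreover have "filterlim (\<lambda>n. of_real (inverse (real (Suc n) + 1)) :: complex) (at 0) sequentially"
  proof -
    have "(\<lambda>n. inverse (real (Suc n) + 1)) \<longlonglongrightarrow> 0"
      using LIMSEQ_Suc[OF LIMSEQ_inverse_real_of_nat] by (simp add: add.commute)
    then have "(\<lambda>n. of_real (inverse (real (Suc n) + 1)) :: complex) \<longlonglongrightarrow> of_real 0"
      by (rule tendsto_of_real)
    moreover have "of_real (inverse (real (Suc n) + 1)) \<noteq> (0 :: complex)" for n
      unfolding of_real_eq_0_iff by simp
    ultimately show ?thesis
      unfolding filterlim_at by (simp del: of_real_inverse of_real_add)
  qed
  ultimately have "(\<lambda>n. \<Sum>k. b k * of_real (inverse (real (Suc n) + 1)) ^ k) \<longlonglongrightarrow> b 0"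
    by (rule filterlim_compose)
  moreover have "(\<Sum>k. b k * of_real (inverse (real (Suc n) + 1)) ^ k) = 0" for n
    by (rule sums_unique[symmetric], rule b0) (auto simp: field_simps)
  ultimately have "(\<lambda>n::nat. 0) \<longlonglongrightarrow> b 0" by simp
  then have "b 0 = 0" by (simp add: LIMSEQ_const_iff)
  then show False using m by (simp add: b_def)
qed

text \<open>
The interleaved coefficients \<open>c (n mod m) (n div m)\<close> form a second power series with the sum of \<open>g\<close>.
\<close>

lemma dissection_coefficients:
  fixes g :: "nat \<Rightarrow> complex" and c :: "nat \<Rightarrow> nat \<Rightarrow> real" and S :: "nat \<Rightarrow> real \<Rightarrow> real"
  assumes m: "0 < m"
    and g: "\<And>q. 0 < q \<Longrightarrow> q < 1 \<Longrightarrow> (\<lambda>n. g n * of_real q ^ n) sums of_real (\<Sum>r<m. q ^ r * S r (q ^ m))"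
    and c: "\<And>r t. r < m \<Longrightarrow> 0 < t \<Longrightarrow> t < 1 \<Longrightarrow> (\<lambda>n. c r n * t ^ n) sums S r t"
    and r: "r < m"
  shows "g (m * n + r) = of_real (c r n)"
proof -
  define b where "b = (\<lambda>n. c (n mod m) (n div m))"
  have "(\<lambda>n. (g n - of_real (b n)) * of_real q ^ n) sums 0" if q: "0 < q" "q < 1" for q
  proof -
    have t: "0 < q ^ m" "q ^ m < 1" using q m by (auto simp: power_less_one_iff)
    have "(\<lambda>n. if n mod m = r then b n * q ^ n else 0) sums (q ^ r * S r (q ^ m))" if r: "r < m" for r
    proof -
      let ?f = "\<lambda>n. if n mod m = r then b n * q ^ n else 0"
      have "strict_mono (\<lambda>n. m * n + r)" using m by (auto simp: strict_mono_def)
      moreover have "?f n = 0" if "n \<notin> range (\<lambda>n. m * n + r)" for n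
      proof (cases "n mod m = r")
        case True
        then have "n = m * (n div m) + r" by (metis mult_div_mod_eq)
        then show ?thesis using that by blast
      qed simp
      ultimately have "?f sums (q ^ r * S r (q ^ m)) \<longleftrightarrow> (\<lambda>n. ?f (m * n + r)) sums (q ^ r * S r (q ^ m))"
        by (rule sums_mono_reindex[symmetric])
      moreover have "?f (m * n + r) = q ^ r * (c r n * (q ^ m) ^ n)" for n
        using r m by (simp add: b_def power_add power_mult mult_ac)
      ultimately show ?thesis
        using sums_mult[OF c[OF r t], of "q ^ r"] by simp
    qed
    then have "(\<lambda>n. \<Sum>r<m. if n mod m = r then b n * q ^ n else 0) sums (\<Sum>r<m. q ^ r * S r (q ^ m))"
      by (intro sums_sum) auto
    moreover have "(\<Sum>r<m. if n mod m = r then b n * q ^ n else 0) = b n * q ^ n" for n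
      using m by simp
    ultimately have "(\<lambda>n. b n * q ^ n) sums (\<Sum>r<m. q ^ r * S r (q ^ m))" by simp
    then have "(\<lambda>n. complex_of_real (b n * q ^ n)) sums of_real (\<Sum>r<m. q ^ r * S r (q ^ m))"
      by (rule sums_of_real)
    then show ?thesis
      using sums_diff[OF g[OF q]] by (fastforce simp: algebra_simps)
  qed
  then have "g (m * n + r) - of_real (b (m * n + r)) = 0"
    by (rule powser_coeffs_zero_of_real_zeros)
  then show ?thesis using r m by (simp add: b_def)
qed

theorem mainTheorem3:
  fixes g1 h1 :: "nat \<Rightarrow> complex"
  assumes g1: "\<And>q. norm q < 1 \<Longrightarrow>
      (\<lambda>n. g1 n * q ^ n) sums
        ((qpochhammer_inf [- q, - (q ^ 4)] (q ^ 5)) ^ 2 * qpochhammer_inf [q ^ 4, q ^ 6] (q ^ 10))"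
    and h1: "\<And>q. norm q < 1 \<Longrightarrow>
      (\<lambda>n. h1 n * q ^ n) sums
        ((qpochhammer_inf [- (q ^ 2), - (q ^ 3)] (q ^ 5)) ^ 2 * qpochhammer_inf [q ^ 2, q ^ 8] (q ^ 10))"
  shows "\<forall>n.
      g1 (5 * n) = of_nat (num_partitions (cong_pm 10 {1, 2, 4})
        (\<lambda>k. if k \<in> cong_pm 10 {1, 4} then 2 else 1) n) \<and>
      g1 (5 * n + 1) = 2 * of_nat (num_partitions (cong_pm 10 {1, 2, 3, 4})
        (\<lambda>k. if k \<in> cong_pm 10 {2} then 2 else 1) n) \<and>
      g1 (5 * n + 2) = of_nat (num_partitions (cong_pm 10 {1, 4})
        (\<lambda>k. if k \<in> cong_pm 10 {1} then 2 else 3) n) \<and>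
      g1 (5 * n + 4) = of_nat (num_partitions (cong_pm 10 {2, 3, 4})
        (\<lambda>k. if k \<in> cong_pm 10 {2, 3} then 2 else 1) n) \<and>
      h1 (5 * n) = of_nat (num_partitions (cong_pm 10 {1, 2, 4})
        (\<lambda>k. if k \<in> cong_pm 10 {1, 4} then 2 else 1) n) \<and>
      h1 (5 * n + 2) = of_nat (num_partitions (cong_pm 10 {2, 3})
        (\<lambda>k. if k \<in> cong_pm 10 {3} then 2 else 3) n) \<and>
      h1 (5 * n + 3) = 2 * of_nat (num_partitions (cong_pm 10 {1, 2, 3, 4})
        (\<lambda>k. if k \<in> cong_pm 10 {4} then 2 else 1) n) \<and>
      - h1 (5 * n + 4) = of_nat (num_partitions (cong_pm 10 {2, 3, 4})
        (\<lambda>k. if k \<in> cong_pm 10 {2, 3} then 2 else 1) n)"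
proof -
  define p0 where "p0 = (\<lambda>n. real (num_partitions (cong_pm 10 {1, 2, 4}) (\<lambda>k. if k \<in> cong_pm 10 {1, 4} then 2 else 1) n))"
  define p1 where "p1 = (\<lambda>n. real (num_partitions (cong_pm 10 {1, 2, 3, 4}) (\<lambda>k. if k \<in> cong_pm 10 {2} then 2 else 1) n))"
  define p2 where "p2 = (\<lambda>n. real (num_partitions (cong_pm 10 {1, 4}) (\<lambda>k. if k \<in> cong_pm 10 {1} then 2 else 3) n))"
  define p4 where "p4 = (\<lambda>n. real (num_partitions (cong_pm 10 {2, 3, 4}) (\<lambda>k. if k \<in> cong_pm 10 {2, 3} then 2 else 1) n))"
  define p2' where "p2' = (\<lambda>n. real (num_partitions (cong_pm 10 {2, 3}) (\<lambda>k. if k \<in> cong_pm 10 {3} then 2 else 3) n))"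
  define p3' where "p3' = (\<lambda>n. real (num_partitions (cong_pm 10 {1, 2, 3, 4}) (\<lambda>k. if k \<in> cong_pm 10 {4} then 2 else 1) n))"
  have sums: "(\<lambda>n. p0 n * t ^ n) sums quotient3 (triple_class 10 4) (triple_class 5 2) (triple_class 5 2) t"
      "(\<lambda>n. 2 * p1 n * t ^ n) sums (2 * quotient3 (triple_class 10 4) (triple_class 5 2) (triple_class 5 1) t)"
    "(\<lambda>n. p2 n * t ^ n) sums quotient3 (triple_class 10 2) (triple_class 5 2) (triple_class 5 2) t"
        "(\<lambda>n. p4 n * t ^ n) sums quotient3 (triple_class 10 2) (triple_class 5 1) (triple_class 5 1) t"
    "(\<lambda>n. p2' n * t ^ n) sums quotient3 (triple_class 10 4) (triple_class 5 1) (triple_class 5 1) t"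
        "(\<lambda>n. 2 * p3' n * t ^ n) sums (2 * quotient3 (triple_class 10 2) (triple_class 5 2) (triple_class 5 1) t)"
    "(\<lambda>n. - p4 n * t ^ n) sums (- quotient3 (triple_class 10 2) (triple_class 5 1) (triple_class 5 1) t)"
    if t: "0 < t" "t < 1" for t
    using partition_sums[OF t] sums_mult[OF partition_sums(2)[OF t], of 2] sums_mult[OF partition_sums(6)[OF t], of 2]
      sums_minus[OF partition_sums(4)[OF t]]
    by (simp_all add: p0_def p1_def p2_def p4_def p2'_def p3'_def mult.assoc)
  define Sg where "Sg = (\<lambda>r t. [quotient3 (triple_class 10 4) (triple_class 5 2) (triple_class 5 2) t,
      2 * quotient3 (triple_class 10 4) (triple_class 5 2) (triple_class 5 1) t,
      quotient3 (triple_class 10 2) (triple_class 5 2) (triple_class 5 2) t,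
      0, quotient3 (triple_class 10 2) (triple_class 5 1) (triple_class 5 1) t] ! r)"
  define cg where "cg = (\<lambda>r n. [p0 n, 2 * p1 n, p2 n, 0, p4 n] ! r)"
  define Sh where "Sh = (\<lambda>r t. [quotient3 (triple_class 10 4) (triple_class 5 2) (triple_class 5 2) t,
      0, quotient3 (triple_class 10 4) (triple_class 5 1) (triple_class 5 1) t,
      2 * quotient3 (triple_class 10 2) (triple_class 5 2) (triple_class 5 1) t,
      - quotient3 (triple_class 10 2) (triple_class 5 1) (triple_class 5 1) t] ! r)"
  define ch where "ch = (\<lambda>r n. [p0 n, 0, p2' n, 2 * p3' n, - p4 n] ! r)"
  have less5: "r = 0 \<or> r = 1 \<or> r = 2 \<or> r = 3 \<or> r = 4" if "r < 5" for r :: nat using that by arith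
  have sum5: "(\<Sum>r<5. f r) = f 0 + f 1 + f 2 + f 3 + f 4" for f :: "nat \<Rightarrow> real"
    by (simp add: eval_nat_numeral)
  have g: "g1 (5 * n + r) = of_real (cg r n)" if "r < 5" for r n
  proof (rule dissection_coefficients[where S = Sg])
    fix q :: real assume q: "0 < q" "q < 1"
    define r where "r = sqrt q"
    have r: "0 < r" "r < 1" using q by (auto simp: r_def)
    have rq: "r\<^sup>2 = q" using q by (simp add: r_def)
    have r10: "r ^ 10 = q ^ 5" by (simp add: rq[symmetric] power_mult[symmetric])
    have "(\<Sum>r<5. q ^ r * Sg r (q ^ 5)) = (theta (r ^ 3) (r ^ 5))\<^sup>2 * theta (- q) (q ^ 5) / euler_product (\<lambda>k. 2 + on_class 2 2 k) (q ^ 5)"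
      unfolding theta_quotients(1)[OF r, unfolded rq r10] sum5 by (simp add: Sg_def)
    then show "(\<lambda>n. g1 n * of_real q ^ n) sums of_real (\<Sum>r<5. q ^ r * Sg r (q ^ 5))"
      using g1[of "of_real q"] q generating_functions(1)[OF r, unfolded rq r10] by simp
  next
    fix r :: nat and t :: real assume r: "r < 5" and t: "0 < t" "t < 1"
    show "(\<lambda>n. cg r n * t ^ n) sums Sg r t"
      using less5[OF r] sums[OF t] by (elim disjE) (simp_all add: cg_def Sg_def)
  qed (use that in auto)
  have h: "h1 (5 * n + r) = of_real (ch r n)" if "r < 5" for r n
  proof (rule dissection_coefficients[where S = Sh])
    fix q :: real assume q: "0 < q" "q < 1"
    define r where "r = sqrt q"
    have r: "0 < r" "r < 1" using q by (auto simp: r_def)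
    have rq: "r\<^sup>2 = q" using q by (simp add: r_def)
    have r10: "r ^ 10 = q ^ 5" by (simp add: rq[symmetric] power_mult[symmetric])
    have "(\<Sum>r<5. q ^ r * Sh r (q ^ 5)) = (theta r (r ^ 5))\<^sup>2 * theta (- (q ^ 3)) (q ^ 5) / euler_product (\<lambda>k. 2 + on_class 2 2 k) (q ^ 5)"
      unfolding theta_quotients(2)[OF r, unfolded rq r10] sum5 by (simp add: Sh_def)
    then show "(\<lambda>n. h1 n * of_real q ^ n) sums of_real (\<Sum>r<5. q ^ r * Sh r (q ^ 5))"
      using h1[of "of_real q"] q generating_functions(2)[OF r, unfolded rq r10] by simp
  next
    fix r :: nat and t :: real assume r: "r < 5" and t: "0 < t" "t < 1"
    show "(\<lambda>n. ch r n * t ^ n) sums Sh r t"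
      using less5[OF r] sums[OF t] by (elim disjE) (simp_all add: ch_def Sh_def)
  qed (use that in auto)
  show ?thesis
    using g[of 0] g[of 1] g[of 2] g[of 4] h[of 0] h[of 2] h[of 3] h[of 4]
    by (simp add: cg_def ch_def p0_def p1_def p2_def p4_def p2'_def p3'_def)
qed

end
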